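(* Let $n\ge3$, let $f:[0,\infty)\to\mathbb R$ be a continuous function and assume that $s^{-(n+2)/(n-2)}f(s)$ is strictly decreasing on $(0,\infty)$. Then any solution $v\in C^2(\mathbb S^n)$ of $$-\mathcal L_{\mathbb S^n}v=f(v)\quad\text{and}\quad v>0\quad\text{on }\mathbb S^n$$ must be a constant $v\equiv c$ on $\mathbb S^n$ satisfying $f(c)=\frac{n(n-2)}4c$.
   Context: $\mathbb S^n$ is the unit sphere in $\mathbb R^{n+1}$ with its standard metric, and $\mathcal L_{\mathbb S^n}:=\Delta_{\mathbb S^n}-\frac{n(n-2)}4$ with $\Delta_{\mathbb S^n}$ the Laplace–Beltrami operator. *)

theory Defs
  imports "HOL-Analysis.Analysis"
begin

definition C2_on :: "'a::euclidean_space set \<Rightarrow> ('a \<Rightarrow> real) \<Rightarrow> bool" where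
  "C2_on U w \<longleftrightarrow>
     (\<exists>(w' :: 'a \<Rightarrow> 'a \<Rightarrow>\<^sub>L real) (w'' :: 'a \<Rightarrow> 'a \<Rightarrow>\<^sub>L ('a \<Rightarrow>\<^sub>L real)).
        (\<forall>x\<in>U. (w has_derivative blinfun_apply (w' x)) (at x)) \<and>
        (\<forall>x\<in>U. (w' has_derivative blinfun_apply (w'' x)) (at x)) \<and>
        continuous_on U w'')"

text \<open>The unit sphere is treated as an embedded submanifold: a function on it is of class $C^2$
  if near each of its points it is the restriction of a $C^2$ function on an open subset of the
  ambient space. In this and in the following definitions the values of a function off the
  sphere play no role.\<close>

definition C2_sphere :: "('a::euclidean_space \<Rightarrow> real) \<Rightarrow> bool" where
  "C2_sphere v \<longleftrightarrow>
     (\<forall>x\<in>sphere 0 1. \<exists>U w. open U \<and> x \<in> U \<and> C2_on U w \<and> (\<forall>y\<in>U \<inter> sphere 0 1. w y = v y))"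

definition tangent_proj :: "'a::euclidean_space \<Rightarrow> 'a \<Rightarrow> 'a" where
  "tangent_proj x h = h - (h \<bullet> x) *\<^sub>R x"

text \<open>A derivative at \<open>x\<close> within the sphere is determined precisely on the tangent space
  \<open>{h. h \<bullet> x = 0}\<close>, so requiring the gradient to be tangent makes it unique.\<close>

definition sphere_grad :: "('a::euclidean_space \<Rightarrow> real) \<Rightarrow> 'a \<Rightarrow> 'a" where
  "sphere_grad v x =
     (THE g. g \<bullet> x = 0 \<and> (v has_derivative (\<lambda>h. g \<bullet> h)) (at x within sphere 0 1))"

text \<open>The Levi-Civita derivative of a tangent field \<open>X\<close> in a tangent direction \<open>h\<close> is the tangential
  part of the ambient derivative, and the divergence is the trace of this endomorphism of the tangent
  space. With \<open>P = tangent_proj x\<close> and \<open>D\<close> the derivative of \<open>X\<close>, it is the trace of \<open>P \<circ> D \<circ> P\<close> on the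
  ambient space; only values of \<open>D\<close> on tangent vectors enter, so the choice of \<open>D\<close> made by
  \<^const>\<open>frechet_derivative\<close> is immaterial.\<close>

definition sphere_div :: "('a::euclidean_space \<Rightarrow> 'a) \<Rightarrow> 'a \<Rightarrow> real" where
  "sphere_div X x =
     (\<Sum>b\<in>Basis. tangent_proj x (frechet_derivative X (at x within sphere 0 1) (tangent_proj x b)) \<bullet> b)"

definition sphere_laplacian :: "('a::euclidean_space \<Rightarrow> real) \<Rightarrow> 'a \<Rightarrow> real" where
  "sphere_laplacian v = sphere_div (sphere_grad v)"

text \<open>Here \<open>n\<close> is the dimension of the sphere, i.e. one less than that of the ambient space.\<close>

definition conformal_laplacian :: "nat \<Rightarrow> ('a::euclidean_space \<Rightarrow> real) \<Rightarrow> 'a \<Rightarrow> real" where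
  "conformal_laplacian n v x = sphere_laplacian v x - real n * (real n - 2) / 4 * v x"

end

theory Submission
  imports Defs
begin

text \<open>The proof is a moving-plane argument, with spherical caps in the place of half-spaces and
  conformal reflections in the place of mirror reflections.

  All analysis takes place in the ambient space.  With \<open>\<alpha> = 1 - n/2\<close>, the function \<open>v\<close> is extended to
  \<open>V y = \<bar>y\<bar>\<^sup>\<alpha> v (y / \<bar>y\<bar>)\<close>.  On the sphere, \<open>\<Delta>V = \<Delta>\<^sub>S v + \<alpha> (\<alpha> + n - 1) v\<close>, and \<open>\<alpha>\<close> is a root of
  \<open>\<alpha> (\<alpha> + n - 1) = - n (n - 2) / 4\<close>; so there the conformal Laplacian of \<open>v\<close> is the Euclidean
  Laplacian of \<open>V\<close> (\<open>sphere_laplacian_eq\<close>).  With \<open>g s = s\<^sup>-\<^sup>p f s\<close>, \<open>p = (n + 2) / (n - 2)\<close>, the equation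
  becomes \<open>- \<Delta>V = g (\<bar>y\<bar>\<^sup>-\<^sup>\<alpha> V) V\<^sup>p\<close> off the origin, where \<open>g\<close> is strictly decreasing.

  Conformal maps of the sphere are Lorentz transformations of the light cone \<open>{(y, \<bar>y\<bar>)}\<close>.  For a
  unit vector \<open>e\<close> and \<open>0 \<le> t < 1\<close> let \<open>\<phi>\<close> be the Lorentz reflection that fixes the boundary of the cap
  \<open>{x. x \<bullet> e > t}\<close> of the sphere.  For this exponent \<open>\<alpha>\<close>, functions homogeneous of degree \<open>\<alpha>\<close> satisfy
  \<open>\<Delta>(V \<circ> \<phi>) = (\<Delta>V) \<circ> \<phi>\<close> (\<open>has_laplacian_lorentz_reflection\<close>); this follows from Euler's
  relations.  Inside the cap \<open>\<bar>\<phi> x\<bar> < 1\<close> when \<open>t > 0\<close>, hence where \<open>W = V \<circ> \<phi> - V \<le> 0\<close> the strict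
  monotonicity of \<open>g\<close> gives \<open>\<Delta>W < - C W\<close> for a constant \<open>C\<close> (\<open>laplacian_difference_less\<close>).

  Consequently \<open>W\<close> cannot touch zero from above inside the cap, and by comparison with an explicit
  barrier \<open>W\<close> cannot be negative only in a thin layer along the boundary of the cap
  (\<open>negative_point_deep_in_cap\<close>).  Caps with \<open>t\<close> near 1 are such layers themselves, so there \<open>W \<ge> 0\<close>.
  At the supremum of those \<open>t\<close> for which \<open>W\<close> is negative somewhere, compactness would give an
  interior zero of \<open>W \<ge> 0\<close>, which is impossible; so \<open>W \<ge> 0\<close> on the cap for every \<open>t > 0\<close>
  (\<open>reflected_ge_on_cap\<close>).

  For \<open>t \<rightarrow> 0\<close> the map \<open>\<phi>\<close> tends to the mirror reflection in the hyperplane orthogonal to \<open>e\<close>.  Any two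
  points of the sphere are exchanged by such a mirror, so \<open>v\<close> takes the same value at both.\<close>

section \<open>Pointwise Laplacians and minima\<close>

definition op_trace :: "('a::euclidean_space \<Rightarrow> 'a) \<Rightarrow> real" where
  "op_trace A = (\<Sum>b\<in>Basis. A b \<bullet> b)"

text \<open>Only a gradient near \<open>x\<close> and its derivative at \<open>x\<close> are asked for: this is what the second derivative
  test uses, and it is easily transported through explicit formulas.\<close>

definition has_laplacian :: "('a::euclidean_space \<Rightarrow> real) \<Rightarrow> real \<Rightarrow> 'a \<Rightarrow> bool" where
  "has_laplacian u L x \<longleftrightarrow>
     (\<exists>G H. (\<forall>\<^sub>F y in nhds x. (u has_derivative (\<lambda>h. G y \<bullet> h)) (at y)) \<and>
            (G has_derivative H) (at x) \<and> L = op_trace H)"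

lemma has_laplacianI:
  assumes "\<forall>\<^sub>F y in nhds x. (u has_derivative (\<lambda>h. G y \<bullet> h)) (at y)"
    and "(G has_derivative H) (at x)" "L = op_trace H"
  shows "has_laplacian u L x"
  using assms unfolding has_laplacian_def by blast

lemma op_trace_add: "op_trace (\<lambda>h. A h + B h) = op_trace A + op_trace B"
  by (simp add: op_trace_def inner_add_left sum.distrib)

lemma op_trace_diff: "op_trace (\<lambda>h. A h - B h) = op_trace A - op_trace B"
  by (simp add: op_trace_def inner_diff_left sum_subtractf)

lemma op_trace_scaleR: "op_trace (\<lambda>h. c *\<^sub>R A h) = c * op_trace A"
  by (simp add: op_trace_def sum_distrib_left)

lemma op_trace_id: "op_trace (\<lambda>h::'a::euclidean_space. h) = DIM('a)"
  by (simp add: op_trace_def inner_Basis)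

lemma op_trace_rank1: "op_trace (\<lambda>h. (q \<bullet> h) *\<^sub>R p) = q \<bullet> p"
  by (subst euclidean_inner) (simp add: op_trace_def)

text \<open>This and the preceding rule evaluate the traces of the rank-one terms that the product rule
  produces in the second derivatives below.\<close>

lemma op_trace_rank1_linear:
  assumes "linear A"
  shows "op_trace (\<lambda>h. (A h \<bullet> p) *\<^sub>R q) = A q \<bullet> p"
proof -
  have "A q = (\<Sum>b\<in>Basis. (q \<bullet> b) *\<^sub>R A b)"
    by (subst (1) euclidean_representation[of q, symmetric])
      (simp add: linear_sum[OF assms] linear_scale[OF assms])
  then show ?thesis
    by (simp add: op_trace_def inner_sum_left mult.commute)
qed

lemma has_laplacian_add:
  assumes "has_laplacian u L x" "has_laplacian w M x"
  shows "has_laplacian (\<lambda>y. u y + w y) (L + M) x"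
proof -
  obtain G H where 1: "\<forall>\<^sub>F y in nhds x. (u has_derivative (\<lambda>h. G y \<bullet> h)) (at y)"
    "(G has_derivative H) (at x)" "L = op_trace H"
    using assms(1) unfolding has_laplacian_def by blast
  obtain G' H' where 2: "\<forall>\<^sub>F y in nhds x. (w has_derivative (\<lambda>h. G' y \<bullet> h)) (at y)"
    "(G' has_derivative H') (at x)" "M = op_trace H'"
    using assms(2) unfolding has_laplacian_def by blast
  have "\<forall>\<^sub>F y in nhds x. ((\<lambda>y. u y + w y) has_derivative (\<lambda>h. (G y + G' y) \<bullet> h)) (at y)"
    using 1(1) 2(1) by eventually_elim (simp add: inner_add_left has_derivative_add)
  moreover have "((\<lambda>y. G y + G' y) has_derivative (\<lambda>h. H h + H' h)) (at x)"
    using 1(2) 2(2) by (rule has_derivative_add)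
  ultimately show ?thesis
    by (rule has_laplacianI) (simp add: 1(3) 2(3) op_trace_add)
qed

lemma has_laplacian_cmult:
  assumes "has_laplacian u L x"
  shows "has_laplacian (\<lambda>y. c * u y) (c * L) x"
proof -
  obtain G H where 1: "\<forall>\<^sub>F y in nhds x. (u has_derivative (\<lambda>h. G y \<bullet> h)) (at y)"
    "(G has_derivative H) (at x)" "L = op_trace H"
    using assms(1) unfolding has_laplacian_def by blast
  have "\<forall>\<^sub>F y in nhds x. ((\<lambda>y. c * u y) has_derivative (\<lambda>h. (c *\<^sub>R G y) \<bullet> h)) (at y)"
    using 1(1) by eventually_elim (simp add: has_derivative_mult_right)
  moreover have "((\<lambda>y. c *\<^sub>R G y) has_derivative (\<lambda>h. c *\<^sub>R H h)) (at x)"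
    using 1(2) by (rule has_derivative_scaleR_right)
  ultimately show ?thesis
    by (rule has_laplacianI) (simp add: 1(3) op_trace_scaleR)
qed

lemma has_laplacian_diff:
  assumes "has_laplacian u L x" "has_laplacian w M x"
  shows "has_laplacian (\<lambda>y. u y - w y) (L - M) x"
  using has_laplacian_add[OF assms(1) has_laplacian_cmult[OF assms(2), of "-1"]] by simp

text \<open>Along each coordinate direction the slope vanishes at the minimum.  A negative second derivative
  would make the slope negative immediately afterwards, so the function would decrease.\<close>

lemma local_min_laplacian_nonneg:
  assumes "has_laplacian u L x" and min: "\<forall>\<^sub>F y in nhds x. u x \<le> u y"
  shows "0 \<le> L"
proof -
  obtain G H where G: "\<forall>\<^sub>F y in nhds x. (u has_derivative (\<lambda>h. G y \<bullet> h)) (at y)"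
    and H: "(G has_derivative H) (at x)" and L: "L = op_trace H"
    using assms(1) unfolding has_laplacian_def by blast
  obtain d where d: "d > 0" and
    D: "\<And>y. dist y x < d \<Longrightarrow> (u has_derivative (\<lambda>h. G y \<bullet> h)) (at y) \<and> u x \<le> u y"
    using eventually_conj[OF G min] unfolding eventually_nhds_metric by auto
  have "H b \<bullet> b \<ge> 0" if b: "b \<in> Basis" for b
  proof (rule ccontr)
    assume neg: "\<not> 0 \<le> H b \<bullet> b"
    define p where "p s = x + s *\<^sub>R b" for s :: real
    have nb: "norm b = 1" using b by simp
    have dp: "dist (p s) x = \<bar>s\<bar>" for s
      by (simp add: p_def dist_norm nb)
    have p': "(p has_derivative (\<lambda>k. k *\<^sub>R b)) (at s)" for s
      unfolding p_def by (auto intro!: derivative_eq_intros)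
    have up: "((u \<circ> p) has_real_derivative G (p s) \<bullet> b) (at s)" if "\<bar>s\<bar> < d" for s
    proof -
      have "(u has_derivative (\<lambda>h. G (p s) \<bullet> h)) (at (p s))"
        using D[of "p s"] that dp by simp
      from has_derivative_compose[OF p' this]
      show ?thesis by (simp add: has_field_derivative_def o_def mult.commute[of _ "_ \<bullet> _"])
    qed
    have gp: "((\<lambda>s. G (p s) \<bullet> b) has_real_derivative H b \<bullet> b) (at 0)"
    proof -
      have H0: "(G has_derivative H) (at (p 0))" using H by (simp add: p_def)
      have lin: "linear H" using H has_derivative_linear by blast
      have "((\<lambda>s. G (p s) \<bullet> b) has_derivative (\<lambda>k. H (k *\<^sub>R b) \<bullet> b)) (at 0)"
        by (rule has_derivative_inner_left[OF has_derivative_compose[OF p' H0]])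
      then show ?thesis
        by (simp add: has_field_derivative_def linear_scale[OF lin] mult.commute[of _ "_ \<bullet> _"])
    qed
    have g0: "G (p 0) \<bullet> b = 0"
      by (rule DERIV_local_min[OF up[of 0] d])
        (use D dp d in \<open>auto simp: p_def dist_norm nb\<close>)
    obtain e where e: "e > 0" "\<And>k. 0 < k \<Longrightarrow> k < e \<Longrightarrow> G (p k) \<bullet> b < 0"
      using DERIV_neg_dec_right[OF gp] neg g0 by (auto simp: not_le)
    define k where "k = min d e / 2"
    have k: "0 < k" "k < d" "k < e" using d e by (auto simp: k_def min_def)
    obtain z where z: "0 < z" "z < k" "(u \<circ> p) k - (u \<circ> p) 0 = (k - 0) * (G (p z) \<bullet> b)"
      using MVT2[of 0 k "u \<circ> p" "\<lambda>s. G (p s) \<bullet> b"] up k by auto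
    have "(k - 0) * (G (p z) \<bullet> b) < 0"
      using e(2)[of z] z k by (simp add: mult_less_0_iff)
    moreover have "u x \<le> u (p k)" using D[of "p k"] dp[of k] k by simp
    ultimately show False using z(3) by (simp add: p_def)
  qed
  then show ?thesis unfolding L op_trace_def by (intro sum_nonneg)
qed

text \<open>The difference of the two functions is locally constant, so the second derivative test applies to
  it and to its negative.\<close>

lemma has_laplacian_unique:
  assumes u: "has_laplacian u L x" and w: "has_laplacian w M x"
    and eq: "\<forall>\<^sub>F y in nhds x. u y = w y"
  shows "L = M"
proof (rule antisym)
  have x: "u x = w x" using eq by (rule eventually_nhds_x_imp_x)
  have "0 \<le> M - L"
    by (rule local_min_laplacian_nonneg[OF has_laplacian_diff[OF w u]])
      (use eq x in \<open>auto elim: eventually_mono\<close>)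
  then show "L \<le> M" by simp
  have "0 \<le> L - M"
    by (rule local_min_laplacian_nonneg[OF has_laplacian_diff[OF u w]])
      (use eq x in \<open>auto elim: eventually_mono\<close>)
  then show "M \<le> L" by simp
qed

section \<open>Homogeneous functions and Lorentz reflections\<close>

locale homogeneous_hessian =
  fixes V :: "'a::euclidean_space \<Rightarrow> real" and \<alpha> :: real
    and G :: "'a \<Rightarrow> 'a" and H :: "'a \<Rightarrow> 'a \<Rightarrow> 'a"
  assumes hom: "s > 0 \<Longrightarrow> y \<noteq> 0 \<Longrightarrow> V (s *\<^sub>R y) = s powr \<alpha> * V y"
    and grad: "y \<noteq> 0 \<Longrightarrow> (V has_derivative (\<lambda>h. G y \<bullet> h)) (at y)"
    and hess: "y \<noteq> 0 \<Longrightarrow> (G has_derivative H y) (at y)"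
begin

lemma linear_hess: "y \<noteq> 0 \<Longrightarrow> linear (H y)"
  using hess has_derivative_linear by blast

lemma has_laplacian_V: "y \<noteq> 0 \<Longrightarrow> has_laplacian V (op_trace (H y)) y"
  by (rule has_laplacianI[OF eventually_mono[OF t1_space_nhds[of y 0]] hess refl]) (simp_all add: grad)

lemma G_homogeneous:
  assumes s: "s > 0" and y: "y \<noteq> 0"
  shows "G (s *\<^sub>R y) = s powr (\<alpha> - 1) *\<^sub>R G y"
proof -
  have sy: "s *\<^sub>R y \<noteq> 0" using s y by simp
  have "((\<lambda>z. s *\<^sub>R z) has_derivative (\<lambda>h. s *\<^sub>R h)) (at y)"
    by (auto intro!: derivative_eq_intros)
  from has_derivative_compose[OF this grad[OF sy]]
  have 1: "((\<lambda>z. V (s *\<^sub>R z)) has_derivative (\<lambda>h. G (s *\<^sub>R y) \<bullet> (s *\<^sub>R h))) (at y)" .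
  have "((\<lambda>z. s powr \<alpha> * V z) has_derivative (\<lambda>h. s powr \<alpha> * (G y \<bullet> h))) (at y)"
    using grad[OF y] by (rule has_derivative_mult_right)
  then have 2: "((\<lambda>z. V (s *\<^sub>R z)) has_derivative (\<lambda>h. s powr \<alpha> * (G y \<bullet> h))) (at y)"
    by (rule has_derivative_transform_within_open[of _ _ _ _ "- {0}"]) (use y s hom in auto)
  have "G (s *\<^sub>R y) \<bullet> (s *\<^sub>R h) = s powr \<alpha> * (G y \<bullet> h)" for h
    using fun_cong[OF has_derivative_unique[OF 1 2]] .
  then have "s *\<^sub>R G (s *\<^sub>R y) = s powr \<alpha> *\<^sub>R G y"
    by (subst vector_eq_rdot[symmetric]) (simp add: inner_commute)
  then have "s *\<^sub>R G (s *\<^sub>R y) = s *\<^sub>R (s powr (\<alpha> - 1) *\<^sub>R G y)"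
    using s by (simp add: powr_diff)
  then show ?thesis using s by (simp only: scaleR_cancel_left) simp
qed

lemma H_homogeneous:
  assumes s: "s > 0" and y: "y \<noteq> 0"
  shows "H (s *\<^sub>R y) h = s powr (\<alpha> - 2) *\<^sub>R H y h"
proof -
  have sy: "s *\<^sub>R y \<noteq> 0" using s y by simp
  have "((\<lambda>z. s *\<^sub>R z) has_derivative (\<lambda>h. s *\<^sub>R h)) (at y)"
    by (auto intro!: derivative_eq_intros)
  from has_derivative_compose[OF this hess[OF sy]]
  have 1: "((\<lambda>z. G (s *\<^sub>R z)) has_derivative (\<lambda>h. H (s *\<^sub>R y) (s *\<^sub>R h))) (at y)" .
  have "((\<lambda>z. s powr (\<alpha> - 1) *\<^sub>R G z) has_derivative (\<lambda>h. s powr (\<alpha> - 1) *\<^sub>R H y h)) (at y)"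
    using hess[OF y] by (rule has_derivative_scaleR_right)
  then have 2: "((\<lambda>z. G (s *\<^sub>R z)) has_derivative (\<lambda>h. s powr (\<alpha> - 1) *\<^sub>R H y h)) (at y)"
    by (rule has_derivative_transform_within_open[of _ _ _ _ "- {0}"])
      (use y s G_homogeneous in auto)
  have "s *\<^sub>R H (s *\<^sub>R y) h = s powr (\<alpha> - 1) *\<^sub>R H y h"
    using fun_cong[OF has_derivative_unique[OF 1 2], of h] linear_scale[OF linear_hess[OF sy]]
    by simp
  also have "\<dots> = s *\<^sub>R (s powr (\<alpha> - 2) *\<^sub>R H y h)"
    using s by (simp add: powr_diff power2_eq_square)
  finally show ?thesis using s by (simp only: scaleR_cancel_left) simp
qed

lemma euler_gradient:
  assumes y: "y \<noteq> 0"
  shows "G y \<bullet> y = \<alpha> * V y"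
proof -
  have "((\<lambda>s. s *\<^sub>R y) has_derivative (\<lambda>k. k *\<^sub>R y)) (at 1)"
    by (auto intro!: derivative_eq_intros)
  from has_derivative_compose[OF this, of V "\<lambda>h. G y \<bullet> h"]
  have 1: "((\<lambda>s. V (s *\<^sub>R y)) has_derivative (\<lambda>k. G y \<bullet> (k *\<^sub>R y))) (at 1)"
    using grad[OF y] by simp
  have "((\<lambda>s. s powr \<alpha> * V y) has_real_derivative \<alpha> * V y) (at 1)"
    by (auto intro!: derivative_eq_intros)
  then have "((\<lambda>s. s powr \<alpha> * V y) has_derivative (\<lambda>k. \<alpha> * V y * k)) (at 1)"
    by (simp add: has_field_derivative_def)
  then have 2: "((\<lambda>s. V (s *\<^sub>R y)) has_derivative (\<lambda>k. \<alpha> * V y * k)) (at 1)"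
    by (rule has_derivative_transform_within_open[of _ _ _ _ "{0<..}"]) (use y hom in auto)
  show ?thesis using fun_cong[OF has_derivative_unique[OF 1 2], of 1] by simp
qed

text \<open>The two second-order Euler relations arise by differentiating \<open>G y \<bullet> y = \<alpha> V y\<close> in the direction
  \<open>h\<close>, and \<open>G (s y) = s\<^sup>\<alpha>\<^sup>-\<^sup>1 G y\<close> in \<open>s\<close>; they concern the two
  different slots of the bilinear form \<open>H y h \<bullet> k\<close>.\<close>

lemma euler_hess_inner:
  assumes y: "y \<noteq> 0"
  shows "H y h \<bullet> y = (\<alpha> - 1) * (G y \<bullet> h)"
proof -
  have 1: "((\<lambda>z. G z \<bullet> z) has_derivative (\<lambda>h. G y \<bullet> h + H y h \<bullet> y)) (at y)"
    by (rule has_derivative_inner[OF hess[OF y] has_derivative_ident])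
  have "((\<lambda>z. \<alpha> * V z) has_derivative (\<lambda>h. \<alpha> * (G y \<bullet> h))) (at y)"
    using grad[OF y] by (rule has_derivative_mult_right)
  then have 2: "((\<lambda>z. G z \<bullet> z) has_derivative (\<lambda>h. \<alpha> * (G y \<bullet> h))) (at y)"
    by (rule has_derivative_transform_within_open[of _ _ _ _ "- {0}"])
      (use y euler_gradient in auto)
  show ?thesis using fun_cong[OF has_derivative_unique[OF 1 2], of h] by (simp add: algebra_simps)
qed

lemma euler_hess_apply:
  assumes y: "y \<noteq> 0"
  shows "H y y = (\<alpha> - 1) *\<^sub>R G y"
proof -
  have "((\<lambda>s. s *\<^sub>R y) has_derivative (\<lambda>k. k *\<^sub>R y)) (at 1)"
    by (auto intro!: derivative_eq_intros)
  from has_derivative_compose[OF this, of G "H y"]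
  have 1: "((\<lambda>s. G (s *\<^sub>R y)) has_derivative (\<lambda>k. H y (k *\<^sub>R y))) (at 1)"
    using hess[OF y] by simp
  have "((\<lambda>s. s powr (\<alpha> - 1)) has_real_derivative (\<alpha> - 1)) (at 1)"
    by (auto intro!: derivative_eq_intros)
  then have "((\<lambda>s. s powr (\<alpha> - 1)) has_derivative (\<lambda>k. (\<alpha> - 1) * k)) (at 1)"
    by (simp add: has_field_derivative_def)
  then have "((\<lambda>s. s powr (\<alpha> - 1) *\<^sub>R G y) has_derivative (\<lambda>k. ((\<alpha> - 1) * k) *\<^sub>R G y)) (at 1)"
    by (rule has_derivative_scaleR_left)
  then have 2: "((\<lambda>s. G (s *\<^sub>R y)) has_derivative (\<lambda>k. ((\<alpha> - 1) * k) *\<^sub>R G y)) (at 1)"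
    by (rule has_derivative_transform_within_open[of _ _ _ _ "{0<..}"])
      (use y G_homogeneous in auto)
  show ?thesis using fun_cong[OF has_derivative_unique[OF 1 2], of 1] by simp
qed

end

text \<open>With \<open>\<theta>\<close> defined by \<open>t = tanh \<theta>\<close>, this is the action on light-like vectors \<open>(x, \<bar>x\<bar>)\<close> of the
  Lorentz reflection along the space-like unit vector \<open>(cosh \<theta> e, sinh \<theta>)\<close>, written in terms of
  the spatial component alone; note \<open>cosh\<^sup>2 \<theta> = 1 / (1 - t\<^sup>2)\<close>.  It fixes the points with
  \<open>x \<bullet> e = t \<bar>x\<bar>\<close>.\<close>

definition lorentz_reflection :: "'a::euclidean_space \<Rightarrow> real \<Rightarrow> 'a \<Rightarrow> 'a" where
  "lorentz_reflection e t x = x - (2 / (1 - t\<^sup>2) * (x \<bullet> e - t * norm x)) *\<^sub>R e"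

text \<open>The right-hand side is the time component of the reflected vector, which is again light-like and
  future-directed.  For \<open>t > 0\<close> the norm decreases where \<open>x \<bullet> e > t \<bar>x\<bar>\<close>.\<close>

lemma norm_lorentz_reflection:
  assumes e: "norm e = 1" and t: "0 \<le> t" "t < 1"
  shows "norm (lorentz_reflection e t x) = norm x - 2 * t / (1 - t\<^sup>2) * (x \<bullet> e - t * norm x)"
proof -
  define \<kappa> where "\<kappa> = 2 / (1 - t\<^sup>2)"
  define a where "a = x \<bullet> e"
  define r where "r = norm x"
  have t2: "1 - t\<^sup>2 > 0" using t by (simp add: abs_square_less_1)
  have k: "\<kappa> * (1 - t\<^sup>2) = 2" unfolding \<kappa>_def
    by (rule nonzero_eq_divide_eq[THEN iffD1, OF _ refl]) (use t2 in simp)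
  have ee: "e \<bullet> e = 1" using e by (simp add: dot_square_norm)
  have ar: "a \<le> r" using norm_cauchy_schwarz[of x e] e by (simp add: a_def r_def)
  have "(norm (x - c *\<^sub>R e))\<^sup>2 = r\<^sup>2 - 2 * c * a + c\<^sup>2" for c
    unfolding power2_norm_eq_inner r_def a_def
    by (simp add: inner_diff_left inner_diff_right ee inner_commute[of e x] power2_eq_square algebra_simps)
  then have "(norm (lorentz_reflection e t x))\<^sup>2 = r\<^sup>2 - 2 * (\<kappa> * (a - t * r)) * a + (\<kappa> * (a - t * r))\<^sup>2"
    by (simp only: lorentz_reflection_def \<kappa>_def[symmetric] a_def[symmetric] r_def[symmetric])
  also have "\<dots> = (r - t * \<kappa> * (a - t * r))\<^sup>2 + (\<kappa> * (1 - t\<^sup>2) - 2) * \<kappa> * (a - t * r)\<^sup>2"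
    by (simp add: power2_eq_square algebra_simps)
  finally have sq: "(norm (lorentz_reflection e t x))\<^sup>2 = (r - t * \<kappa> * (a - t * r))\<^sup>2"
    using k by simp
  have "(1 - t\<^sup>2) * (r - t * \<kappa> * (a - t * r)) = r - t\<^sup>2 * r - (\<kappa> * (1 - t\<^sup>2)) * t * (a - t * r)"
    by (simp add: algebra_simps)
  also have "\<dots> = (1 - t)\<^sup>2 * r + 2 * (t * (r - a))"
    unfolding k by (simp add: power2_eq_square algebra_simps)
  also have "\<dots> \<ge> 0"
    using ar t(1) by (simp add: r_def)
  finally have "(1 - t\<^sup>2) * (r - t * \<kappa> * (a - t * r)) \<ge> 0" .
  then have "r - t * \<kappa> * (a - t * r) \<ge> 0" using t2 by (simp add: zero_le_mult_iff)
  then have "norm (lorentz_reflection e t x) = r - t * \<kappa> * (a - t * r)"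
    using sq by (simp add: power2_eq_iff_nonneg)
  then show ?thesis by (simp add: \<kappa>_def r_def a_def)
qed

lemma has_derivative_norm_powr:
  fixes y :: "'a::euclidean_space"
  assumes y: "y \<noteq> 0"
  shows "((\<lambda>y. norm y powr \<beta>) has_derivative (\<lambda>h. \<beta> * norm y powr (\<beta> - 2) * (y \<bullet> h))) (at y)"
proof -
  have "((\<lambda>s. s powr \<beta>) has_real_derivative \<beta> * norm y powr (\<beta> - 1)) (at (norm y))"
    using y by (intro has_real_derivative_powr) simp_all
  then have 1: "((\<lambda>s. s powr \<beta>) has_derivative (\<lambda>k. \<beta> * norm y powr (\<beta> - 1) * k)) (at (norm y))"
    by (simp add: has_field_derivative_def)
  have 2: "(norm has_derivative (\<lambda>h. sgn y \<bullet> h)) (at y)"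
    using has_derivative_norm[OF y] unfolding inner_commute[of _ "sgn y"] .
  have "\<beta> * norm y powr (\<beta> - 1) * (sgn y \<bullet> h) = \<beta> * norm y powr (\<beta> - 2) * (y \<bullet> h)" for h
    using y by (simp add: sgn_div_norm powr_diff power2_eq_square divide_simps)
  with has_derivative_compose[OF 2 1] show ?thesis by simp
qed

lemma lorentz_reflection_has_derivative:
  fixes y :: "'a::euclidean_space"
  assumes y: "y \<noteq> 0"
  shows "(lorentz_reflection e t has_derivative
     (\<lambda>h. h - (2 / (1 - t\<^sup>2) * ((e - t *\<^sub>R (norm y powr (-1) *\<^sub>R y)) \<bullet> h)) *\<^sub>R e)) (at y)"
proof -
  have 1: "(norm has_derivative (\<lambda>h. norm y powr (-1) * (y \<bullet> h))) (at y)"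
    using has_derivative_norm_powr[OF y, of 1] by simp
  show ?thesis
    unfolding lorentz_reflection_def[abs_def]
    by (rule derivative_eq_intros 1 refl)+
      (simp add: fun_eq_iff inner_diff_right inner_commute right_diff_distrib)
qed

text \<open>If the norm formula gave zero, then \<open>x \<bullet> e \<le> \<bar>x\<bar>\<close> would force \<open>\<bar>x\<bar> (1 - t)\<^sup>2 \<le> 0\<close>.\<close>

lemma lorentz_reflection_nonzero:
  assumes e: "norm e = 1" and t: "0 \<le> t" "t < 1" and x: "x \<noteq> 0"
  shows "lorentz_reflection e t x \<noteq> 0"
proof
  assume "lorentz_reflection e t x = 0"
  then have n0: "norm x - 2 * t / (1 - t\<^sup>2) * (x \<bullet> e - t * norm x) = 0"
    using norm_lorentz_reflection[OF e t, of x] by simp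
  have t2: "1 - t\<^sup>2 > 0" using t by (simp add: abs_square_less_1)
  have "norm x * (1 - t\<^sup>2) = 2 * t * (x \<bullet> e - t * norm x)"
    using n0 t2 by (simp add: divide_simps)
  moreover have "x \<bullet> e \<le> norm x" using norm_cauchy_schwarz[of x e] e by simp
  then have "t * (x \<bullet> e) \<le> t * norm x" using t by (intro mult_left_mono) auto
  ultimately have "norm x * (1 - t)\<^sup>2 \<le> 0"
    by (simp add: power2_eq_square algebra_simps)
  moreover have "norm x * (1 - t)\<^sup>2 > 0" using x t by simp
  ultimately show False by simp
qed

lemma lorentz_reflection_scaleR:
  assumes "s > 0"
  shows "lorentz_reflection e t (s *\<^sub>R y) = s *\<^sub>R lorentz_reflection e t y"
proof -
  have "(s *\<^sub>R y) \<bullet> e - t * norm (s *\<^sub>R y) = s * (y \<bullet> e - t * norm y)"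
    using assms by (simp add: algebra_simps)
  then show ?thesis by (simp add: lorentz_reflection_def scaleR_diff_right)
qed

text \<open>Conformal covariance.  By the chain rule the Laplacian of \<open>V \<circ> \<phi>\<close> is that of \<open>V\<close> at \<open>\<phi> x\<close> plus
  multiples of \<open>D\<^sup>2V(e, e)\<close>, of \<open>D\<^sup>2V(p, e)\<close> and \<open>D\<^sup>2V(e, p)\<close> for \<open>p = e - t x\<close>, and of \<open>DV(e)\<close>.
  Since \<open>p\<close> is a combination of \<open>e\<close> and \<open>\<phi> x\<close>, Euler's relations reduce the mixed terms to the other
  two.  The coefficient of \<open>D\<^sup>2V(e, e)\<close> then vanishes because \<open>\<phi>\<close> is a Lorentz reflection, and that of
  \<open>DV(e)\<close> because of the value of \<open>\<alpha>\<close>.\<close>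

lemma (in homogeneous_hessian) has_laplacian_lorentz_reflection:
  fixes e x :: 'a
  assumes \<alpha>: "2 * \<alpha> = 3 - real DIM('a)"
    and e: "norm e = 1" and t: "0 \<le> t" "t < 1" and x: "norm x = 1"
  shows "has_laplacian (\<lambda>y. V (lorentz_reflection e t y)) (op_trace (H (lorentz_reflection e t x))) x"
proof -
  define \<kappa> where "\<kappa> = 2 / (1 - t\<^sup>2)"
  define \<phi> where "\<phi> = lorentz_reflection e t"
  define q where "q y = e - t *\<^sub>R (norm y powr (-1) *\<^sub>R y)" for y
  define D where "D y h = h - (\<kappa> * (q y \<bullet> h)) *\<^sub>R e" for y h
  have t2: "1 - t\<^sup>2 > 0" using t by (simp add: abs_square_less_1)
  have k: "\<kappa> * (1 - t\<^sup>2) = 2" unfolding \<kappa>_def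
    by (rule nonzero_eq_divide_eq[THEN iffD1, OF _ refl]) (use t2 in simp)
  have x0: "x \<noteq> 0" using x by auto
  have \<phi>0: "\<phi> y \<noteq> 0" if "y \<noteq> 0" for y
    using lorentz_reflection_nonzero[OF e t that] by (simp add: \<phi>_def)
  have \<phi>': "(\<phi> has_derivative D y) (at y)" if "y \<noteq> 0" for y
    using lorentz_reflection_has_derivative[OF that, of e t]
    by (simp add: \<phi>_def D_def[abs_def] q_def \<kappa>_def)
  \<comment> \<open>The gradient of \<open>V \<circ> \<phi>\<close>: the transpose of \<open>D y\<close> applied to \<open>G (\<phi> y)\<close>.\<close>
  define F where "F y = G (\<phi> y) - (\<kappa> * (G (\<phi> y) \<bullet> e)) *\<^sub>R q y" for y
  define A where "A = H (\<phi> x)"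
  define g where "g = G (\<phi> x)"
  define p where "p = q x"
  have linA: "linear A" unfolding A_def by (rule linear_hess[OF \<phi>0[OF x0]])
  have F: "((\<lambda>y. V (\<phi> y)) has_derivative (\<lambda>h. F y \<bullet> h)) (at y)" if "y \<noteq> 0" for y
  proof -
    have "(\<lambda>h. G (\<phi> y) \<bullet> D y h) = (\<lambda>h. F y \<bullet> h)"
      by (auto simp: D_def F_def inner_diff_left inner_diff_right algebra_simps)
    with has_derivative_compose[OF \<phi>'[OF that] grad[OF \<phi>0[OF that]]] show ?thesis by simp
  qed
  have A: "((\<lambda>y. G (\<phi> y)) has_derivative (\<lambda>h. A (D x h))) (at x)"
    unfolding A_def by (rule has_derivative_compose[OF \<phi>'[OF x0] hess[OF \<phi>0[OF x0]]])
  have ninv: "((\<lambda>y. norm y powr (-1)) has_derivative (\<lambda>h. - (x \<bullet> h))) (at x)"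
    using has_derivative_norm_powr[OF x0, of "-1"] x by simp
  have q': "(q has_derivative (\<lambda>h. - (t *\<^sub>R (h - (x \<bullet> h) *\<^sub>R x)))) (at x)"
    unfolding q_def[abs_def]
    by (rule derivative_eq_intros ninv refl)+ (simp add: x fun_eq_iff algebra_simps)
  define K where "K h = A (D x h) - ((\<kappa> * (g \<bullet> e)) *\<^sub>R (- (t *\<^sub>R (h - (x \<bullet> h) *\<^sub>R x)))
      + (\<kappa> * (A (D x h) \<bullet> e)) *\<^sub>R p)" for h
  have F': "(F has_derivative K) (at x)"
    unfolding F_def[abs_def] K_def[abs_def] g_def p_def
    by (intro has_derivative_diff has_derivative_scaleR has_derivative_mult_right
        has_derivative_inner_left A q')
  have AD: "A (D x h) = A h - (\<kappa> * (p \<bullet> h)) *\<^sub>R A e" for h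
    unfolding D_def p_def by (simp add: linear_diff[OF linA] linear_scale[OF linA])
  have K_eq: "K = (\<lambda>h. (A h - \<kappa> *\<^sub>R ((p \<bullet> h) *\<^sub>R A e)) +
     ((\<kappa> * (g \<bullet> e) * t) *\<^sub>R (h - (x \<bullet> h) *\<^sub>R x) - (\<kappa> *\<^sub>R ((A h \<bullet> e) *\<^sub>R p)
       - (\<kappa> * \<kappa> * (A e \<bullet> e)) *\<^sub>R ((p \<bullet> h) *\<^sub>R p))))"
    unfolding K_def AD by (auto simp: fun_eq_iff algebra_simps inner_diff_left)
  have trK: "op_trace K = op_trace A - \<kappa> * (p \<bullet> A e) + (\<kappa> * (g \<bullet> e) * t * (real DIM('a) - 1)
      - (\<kappa> * (A p \<bullet> e) - \<kappa> * \<kappa> * (A e \<bullet> e) * (p \<bullet> p)))"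
    unfolding K_eq op_trace_add op_trace_diff op_trace_scaleR op_trace_rank1 op_trace_id
      op_trace_rank1_linear[OF linA]
    using x by (simp add: dot_square_norm)
  define a where "a = x \<bullet> e"
  define b where "b = \<kappa> * (a - t)"
  have \<phi>x: "\<phi> x = x - b *\<^sub>R e"
    unfolding \<phi>_def lorentz_reflection_def b_def \<kappa>_def a_def by (simp add: x)
  have p: "p = (1 - t * b) *\<^sub>R e - t *\<^sub>R \<phi> x"
    unfolding p_def q_def \<phi>x using x by (simp add: algebra_simps)
  have e2: "A e \<bullet> \<phi> x = (\<alpha> - 1) * (g \<bullet> e)"
    unfolding A_def g_def by (rule euler_hess_inner[OF \<phi>0[OF x0]])
  have e3: "A (\<phi> x) = (\<alpha> - 1) *\<^sub>R g"
    unfolding A_def g_def by (rule euler_hess_apply[OF \<phi>0[OF x0]])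
  have pAe: "p \<bullet> A e = (1 - t * b) * (A e \<bullet> e) - t * (\<alpha> - 1) * (g \<bullet> e)"
    unfolding p inner_commute[of _ "A e"] using e2
    by (simp add: inner_diff_right)
  have Ape: "A p \<bullet> e = (1 - t * b) * (A e \<bullet> e) - t * (\<alpha> - 1) * (g \<bullet> e)"
    unfolding p by (simp add: linear_diff[OF linA] linear_scale[OF linA] e3 inner_diff_left)
  have pp: "p \<bullet> p = 1 - 2 * t * a + t\<^sup>2"
  proof -
    have ee: "e \<bullet> e = 1" "x \<bullet> x = 1" using e x by (simp_all add: dot_square_norm)
    have pe: "p = e - t *\<^sub>R x" unfolding p_def q_def using x by simp
    show ?thesis unfolding a_def pe
      by (simp add: inner_diff_left inner_diff_right ee inner_commute[of e x]
          power2_eq_square algebra_simps)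
  qed
  have "op_trace K = op_trace A + \<kappa> * t * (g \<bullet> e) * (2 * \<alpha> - 2 + (real DIM('a) - 1))
     + \<kappa> * (A e \<bullet> e) * (\<kappa> * (1 - 2 * t * a + t\<^sup>2) - 2 * (1 - t * b))"
    unfolding trK pAe Ape pp by (simp add: algebra_simps)
  also have "\<kappa> * (1 - 2 * t * a + t\<^sup>2) - 2 * (1 - t * b) = \<kappa> * (1 - t\<^sup>2) - 2"
    unfolding b_def by (simp add: algebra_simps power2_eq_square)
  also have "2 * \<alpha> - 2 + (real DIM('a) - 1) = 0"
    using \<alpha> by simp
  finally have "op_trace K = op_trace A" using k by simp
  moreover have "has_laplacian (\<lambda>y. V (\<phi> y)) (op_trace K) x"
    by (rule has_laplacianI[OF eventually_mono[OF t1_space_nhds[OF x0] F] F' refl])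
  ultimately show ?thesis by (simp add: A_def \<phi>_def)
qed

section \<open>Laplacians of explicit functions\<close>

text \<open>The next two formulas serve to recognise the equation of the constant solution and to compute the
  barrier.\<close>

lemma has_laplacian_norm_powr:
  fixes x :: "'a::euclidean_space"
  assumes x: "norm x = 1"
  shows "has_laplacian (\<lambda>y. norm y powr \<beta>) (\<beta> * (\<beta> + DIM('a) - 2)) x"
proof -
  have x0: "x \<noteq> 0" using x by auto
  define G where "G y = (\<beta> * norm y powr (\<beta> - 2)) *\<^sub>R y" for y :: 'a
  define H where "H h = \<beta> *\<^sub>R h + (\<beta> * (\<beta> - 2)) *\<^sub>R ((x \<bullet> h) *\<^sub>R x)" for h
  have G: "((\<lambda>y. norm y powr \<beta>) has_derivative (\<lambda>h. G y \<bullet> h)) (at y)" if "y \<noteq> 0" for y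
    using has_derivative_norm_powr[OF that, of \<beta>] by (simp add: G_def)
  have "(G has_derivative H) (at x)"
    unfolding G_def[abs_def] H_def[abs_def]
    by (rule derivative_eq_intros has_derivative_norm_powr[OF x0] refl)+ (simp add: x fun_eq_iff)
  moreover have "\<beta> * (\<beta> + DIM('a) - 2) = op_trace H"
    unfolding H_def[abs_def] op_trace_add op_trace_scaleR op_trace_rank1 op_trace_id
    using x by (simp add: dot_square_norm algebra_simps)
  ultimately show ?thesis
    using has_laplacianI[OF eventually_mono[OF t1_space_nhds[OF x0] G]] by blast
qed

lemma has_laplacian_norm_powr_inner:
  fixes x :: "'a::euclidean_space"
  assumes x: "norm x = 1"
  shows "has_laplacian (\<lambda>y. norm y powr \<beta> * (y \<bullet> e)) (\<beta> * (\<beta> + DIM('a)) * (x \<bullet> e)) x"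
proof -
  have x0: "x \<noteq> 0" using x by auto
  define G where "G y = (\<beta> * norm y powr (\<beta> - 2) * (y \<bullet> e)) *\<^sub>R y + norm y powr \<beta> *\<^sub>R e" for y :: 'a
  define H where "H h = (\<beta> * (x \<bullet> e)) *\<^sub>R h + (\<beta> * (\<beta> - 2) * (x \<bullet> e)) *\<^sub>R ((x \<bullet> h) *\<^sub>R x)
     + (\<beta> *\<^sub>R ((e \<bullet> h) *\<^sub>R x) + \<beta> *\<^sub>R ((x \<bullet> h) *\<^sub>R e))" for h
  have G: "((\<lambda>y. norm y powr \<beta> * (y \<bullet> e)) has_derivative (\<lambda>h. G y \<bullet> h)) (at y)" if "y \<noteq> 0" for y
    unfolding G_def
    by (rule derivative_eq_intros has_derivative_norm_powr[OF that] refl)+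
      (simp add: fun_eq_iff inner_add_left inner_commute[of _ e])
  have "(G has_derivative H) (at x)"
    unfolding G_def[abs_def] H_def[abs_def]
    by (rule derivative_eq_intros has_derivative_norm_powr[OF x0] refl)+
      (simp add: x fun_eq_iff algebra_simps inner_commute)
  moreover have "\<beta> * (\<beta> + DIM('a)) * (x \<bullet> e) = op_trace H"
    unfolding H_def[abs_def] op_trace_add op_trace_scaleR op_trace_rank1 op_trace_id
    using x by (simp add: dot_square_norm inner_commute algebra_simps)
  ultimately show ?thesis
    using has_laplacianI[OF eventually_mono[OF t1_space_nhds[OF x0] G]] by blast
qed

section \<open>The conformal Laplacian of the sphere as a Euclidean Laplacian\<close>

text \<open>A tangent direction is the velocity of a great circle, along which both candidates give the
  derivative of the same function of one variable.\<close>

lemma sphere_derivative_unique: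
  fixes F :: "'a::euclidean_space \<Rightarrow> 'b::real_normed_vector"
  assumes D1: "(F has_derivative D1) (at x within sphere 0 1)"
    and D2: "(F has_derivative D2) (at x within sphere 0 1)"
    and x: "norm x = 1" and h: "h \<bullet> x = 0"
  shows "D1 h = D2 h"
proof (cases "h = 0")
  case True
  then show ?thesis
    using D1 D2 by (metis has_derivative_linear linear_0)
next
  case False
  define k where "k = h /\<^sub>R norm h"
  have k: "norm k = 1" "k \<bullet> x = 0" and hk: "h = norm h *\<^sub>R k"
    using False h by (simp_all add: k_def)
  have kk: "k \<bullet> k = 1" "x \<bullet> x = 1" using k x by (simp_all add: dot_square_norm)
  define c where "c s = cos s *\<^sub>R x + sin s *\<^sub>R k" for s :: real
  have c': "(c has_derivative (\<lambda>s. s *\<^sub>R k)) (at 0 within UNIV)"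
    unfolding c_def[abs_def]
    by (auto intro!: derivative_eq_intros)
  have "norm (c s) = 1" for s
  proof -
    have "(norm (c s))\<^sup>2 = (cos s)\<^sup>2 + (sin s)\<^sup>2"
      unfolding power2_norm_eq_inner c_def using k(2) kk
      by (simp add: inner_add_left inner_add_right inner_commute[of x k] power2_eq_square)
    then show ?thesis by (metis norm_ge_zero one_power2 power2_eq_imp_eq sin_cos_squared_add2 zero_le_one)
  qed
  then have sub: "range c \<subseteq> sphere 0 1" by auto
  have c0: "c 0 = x" by (simp add: c_def)
  have 1: "((\<lambda>s. F (c s)) has_derivative (\<lambda>s. D1 (s *\<^sub>R k))) (at 0 within UNIV)"
    by (rule has_derivative_in_compose[OF c'])
      (use has_derivative_subset[OF D1 sub] c0 in simp)
  have 2: "((\<lambda>s. F (c s)) has_derivative (\<lambda>s. D2 (s *\<^sub>R k))) (at 0 within UNIV)"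
    by (rule has_derivative_in_compose[OF c'])
      (use has_derivative_subset[OF D2 sub] c0 in simp)
  have "D1 (norm h *\<^sub>R k) = D2 (norm h *\<^sub>R k)"
    using fun_cong[OF has_derivative_unique[OF 1 2]] .
  then show ?thesis using hk by simp
qed

text \<open>Subtracting a multiple of \<open>\<bar>y\<bar>\<^sup>2 - 1\<close> does not change the values on the sphere and removes the normal
  component of the gradient.\<close>

lemma sphere_grad_eq_tangent_proj:
  assumes V: "(V has_derivative (\<lambda>h. g \<bullet> h)) (at x)" and x: "norm x = 1"
    and v: "\<forall>y\<in>sphere 0 1. v y = V y"
  shows "sphere_grad v x = tangent_proj x g"
  unfolding sphere_grad_def
proof (rule the_equality)
  have xx: "x \<bullet> x = 1" using x by (simp add: dot_square_norm)
  have "((\<lambda>y. V y - (g \<bullet> x) / 2 * (y \<bullet> y - 1)) has_derivative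
      (\<lambda>h. g \<bullet> h - (g \<bullet> x) / 2 * ((x \<bullet> h + h \<bullet> x) - 0))) (at x)"
    by (intro has_derivative_diff has_derivative_mult_right has_derivative_inner
        has_derivative_ident has_derivative_const V)
  also have "(\<lambda>h. g \<bullet> h - (g \<bullet> x) / 2 * ((x \<bullet> h + h \<bullet> x) - 0)) = (\<lambda>h. tangent_proj x g \<bullet> h)"
  proof
    fix h show "g \<bullet> h - (g \<bullet> x) / 2 * ((x \<bullet> h + h \<bullet> x) - 0) = tangent_proj x g \<bullet> h"
      by (simp add: tangent_proj_def inner_diff_left inner_commute[of h x])
  qed
  finally have "((\<lambda>y. V y - (g \<bullet> x) / 2 * (y \<bullet> y - 1)) has_derivative (\<lambda>h. tangent_proj x g \<bullet> h))
      (at x within sphere 0 1)"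
    by (rule has_derivative_at_withinI)
  then have D: "(v has_derivative (\<lambda>h. tangent_proj x g \<bullet> h)) (at x within sphere 0 1)"
    by (rule has_derivative_transform[rotated 2])
      (use x v in \<open>auto simp: dot_square_norm\<close>)
  have T: "tangent_proj x g \<bullet> x = 0" by (simp add: tangent_proj_def inner_diff_left xx)
  show "tangent_proj x g \<bullet> x = 0 \<and>
    (v has_derivative (\<lambda>h. tangent_proj x g \<bullet> h)) (at x within sphere 0 1)"
    using T D by blast
  fix g' assume g': "g' \<bullet> x = 0 \<and> (v has_derivative (\<lambda>h. g' \<bullet> h)) (at x within sphere 0 1)"
  define d where "d = g' - tangent_proj x g"
  have "d \<bullet> x = 0" using g' T by (simp add: d_def inner_diff_left)
  then have "g' \<bullet> d = tangent_proj x g \<bullet> d"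
    using sphere_derivative_unique[OF _ D x] g' by blast
  then have "d \<bullet> d = 0" by (simp add: d_def inner_diff_left)
  then show "g' = tangent_proj x g" by (simp add: d_def)
qed

text \<open>On the sphere the tangential gradient is \<open>G y - \<alpha> V y y\<close>.  The trace of its derivative over the
  tangent space is the full trace minus the normal-normal entry, and Euler's relations evaluate all
  normal components.\<close>

lemma (in homogeneous_hessian) sphere_laplacian_eq:
  assumes x: "norm x = 1" and v: "\<forall>y\<in>sphere 0 1. v y = V y"
  shows "sphere_laplacian v x = op_trace (H x) - \<alpha> * (\<alpha> + DIM('a) - 2) * V x"
proof -
  have x0: "x \<noteq> 0" and xx: "x \<bullet> x = 1" using x by (auto simp: dot_square_norm)
  define X where "X = sphere_grad v"
  have X: "X y = G y - (\<alpha> * V y) *\<^sub>R y" if "y \<in> sphere 0 1" for y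
  proof -
    have y: "norm y = 1" "y \<noteq> 0" using that by auto
    show ?thesis
      unfolding X_def sphere_grad_eq_tangent_proj[OF grad[OF y(2)] y(1) v] tangent_proj_def
      using euler_gradient[OF y(2)] by simp
  qed
  define D where "D h = H x h - (\<alpha> *\<^sub>R ((G x \<bullet> h) *\<^sub>R x) + (\<alpha> * V x) *\<^sub>R h)" for h
  have "((\<lambda>y. G y - (\<alpha> * V y) *\<^sub>R y) has_derivative D) (at x)"
    unfolding D_def[abs_def]
    by (rule derivative_eq_intros grad[OF x0] hess[OF x0] refl)+ (simp add: fun_eq_iff algebra_simps)
  then have "((\<lambda>y. G y - (\<alpha> * V y) *\<^sub>R y) has_derivative D) (at x within sphere 0 1)"
    by (rule has_derivative_at_withinI)
  then have XD: "(X has_derivative D) (at x within sphere 0 1)"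
    by (rule has_derivative_transform[rotated 2]) (use x X in auto)
  then have "X differentiable (at x within sphere 0 1)"
    unfolding differentiable_def by blast
  then have Xf: "(X has_derivative frechet_derivative X (at x within sphere 0 1)) (at x within sphere 0 1)"
    by (simp add: frechet_derivative_works)
  have P: "tangent_proj x h \<bullet> x = 0" for h by (simp add: tangent_proj_def inner_diff_left xx)
  have lin: "linear D" using XD has_derivative_linear by blast
  have PDP: "tangent_proj x (D (tangent_proj x h)) =
      (D h - (D h \<bullet> x) *\<^sub>R x) - ((x \<bullet> h) *\<^sub>R D x - (D x \<bullet> x) *\<^sub>R ((x \<bullet> h) *\<^sub>R x))" for h
    by (simp add: tangent_proj_def linear_diff[OF lin] linear_scale[OF lin] inner_diff_left
        inner_commute[of h x] algebra_simps)
  have "sphere_laplacian v x = op_trace (\<lambda>h. tangent_proj x (D (tangent_proj x h)))"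
    unfolding sphere_laplacian_def sphere_div_def X_def[symmetric] op_trace_def
    by (simp add: sphere_derivative_unique[OF Xf XD x P])
  also have "\<dots> = op_trace D - D x \<bullet> x"
    unfolding PDP op_trace_diff op_trace_scaleR op_trace_rank1 op_trace_rank1_linear[OF lin]
    by (simp add: xx inner_commute)
  also have "op_trace D = op_trace (H x) - (\<alpha> * (\<alpha> * V x) + \<alpha> * V x * DIM('a))"
    unfolding D_def[abs_def] op_trace_diff op_trace_add op_trace_scaleR op_trace_rank1 op_trace_id
    using euler_gradient[OF x0] by simp
  also have "D x \<bullet> x = - 2 * \<alpha> * V x"
    unfolding D_def using euler_gradient[OF x0] euler_hess_inner[OF x0, of x]
    by (simp add: inner_diff_left inner_add_left xx algebra_simps)
  finally show ?thesis by (simp add: algebra_simps)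
qed

lemma C2_on_gradient:
  fixes w :: "'a::euclidean_space \<Rightarrow> real"
  assumes "C2_on U w"
  obtains g where "\<And>x. x \<in> U \<Longrightarrow> (w has_derivative (\<lambda>h. g x \<bullet> h)) (at x)"
    and "\<And>x. x \<in> U \<Longrightarrow> g differentiable (at x)"
proof -
  obtain w' :: "'a \<Rightarrow> 'a \<Rightarrow>\<^sub>L real" and w'' where
    w': "\<And>x. x \<in> U \<Longrightarrow> (w has_derivative blinfun_apply (w' x)) (at x)" and
    w'': "\<And>x. x \<in> U \<Longrightarrow> (w' has_derivative blinfun_apply (w'' x)) (at x)"
    using assms unfolding C2_on_def by blast
  define g where "g x = (\<Sum>b\<in>Basis. blinfun_apply (w' x) b *\<^sub>R b)" for x
  show thesis
  proof (rule that[of g])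
    fix x assume x: "x \<in> U"
    have "blinfun_apply (w' x) = (\<lambda>h. g x \<bullet> h)"
    proof
      fix h
      have lin: "linear (blinfun_apply (w' x))"
        by (rule bounded_linear.linear[OF blinfun.bounded_linear_right])
      have "blinfun_apply (w' x) h = (\<Sum>b\<in>Basis. (h \<bullet> b) * blinfun_apply (w' x) b)"
        by (subst (1) euclidean_representation[of h, symmetric])
          (simp add: linear_sum[OF lin] linear_scale[OF lin])
      then show "blinfun_apply (w' x) h = g x \<bullet> h"
        unfolding g_def inner_sum_left by (simp add: mult.commute inner_commute)
    qed
    then show "(w has_derivative (\<lambda>h. g x \<bullet> h)) (at x)" using w'[OF x] by simp
    have "(\<lambda>y. blinfun_apply (w' y) b) differentiable (at x)" for b
      unfolding differentiable_def
      using bounded_linear.has_derivative[OF blinfun.bounded_linear_left w''[OF x]] by blast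
    then show "g differentiable (at x)"
      unfolding g_def[abs_def] by (intro differentiable_sum differentiable_scaleR) auto
  qed
qed

lemma sgn_has_derivative:
  fixes y :: "'a::euclidean_space"
  assumes y: "y \<noteq> 0"
  shows "(sgn has_derivative
    (\<lambda>h. norm y powr (-1) *\<^sub>R h - (norm y powr (-3) * (y \<bullet> h)) *\<^sub>R y)) (at y)"
proof -
  have "sgn = (\<lambda>y::'a. norm y powr (-1) *\<^sub>R y)"
    by (auto simp: fun_eq_iff sgn_div_norm powr_minus)
  moreover have "((\<lambda>y. norm y powr (-1) *\<^sub>R y) has_derivative
    (\<lambda>h. norm y powr (-1) *\<^sub>R h - (norm y powr (-3) * (y \<bullet> h)) *\<^sub>R y)) (at y)"
    by (rule derivative_eq_intros has_derivative_norm_powr[OF y] refl)+ (simp add: fun_eq_iff)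
  ultimately show ?thesis by simp
qed

text \<open>Near \<open>y0\<close> the function \<open>v\<close> may be replaced by a \<open>C\<^sup>2\<close> function \<open>w\<close> on an open set, so that
  \<open>V y = \<bar>y\<bar>\<^sup>\<alpha> w (y / \<bar>y\<bar>)\<close> has an explicit gradient built from differentiable pieces.\<close>

lemma C2_sphere_local_gradient:
  fixes v :: "'a::euclidean_space \<Rightarrow> real" and \<alpha> :: real
  defines "V \<equiv> \<lambda>y. norm y powr \<alpha> * v (sgn y)"
  assumes v: "C2_sphere v" and y0: "y0 \<noteq> 0"
  shows "\<exists>N F. open N \<and> y0 \<in> N \<and> 0 \<notin> N \<and>
    (\<forall>y\<in>N. (V has_derivative (\<lambda>h. F y \<bullet> h)) (at y)) \<and> F differentiable (at y0)"
proof -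
  have "sgn y0 \<in> sphere 0 1" using y0 by (simp add: norm_sgn)
  then obtain U w where U: "open U" "sgn y0 \<in> U" "C2_on U w" "\<And>y. y \<in> U \<Longrightarrow> norm y = 1 \<Longrightarrow> w y = v y"
    using v unfolding C2_sphere_def by fastforce
  obtain g where g: "\<And>x. x \<in> U \<Longrightarrow> (w has_derivative (\<lambda>h. g x \<bullet> h)) (at x)"
    and g': "\<And>x. x \<in> U \<Longrightarrow> g differentiable (at x)"
    using C2_on_gradient[OF U(3)] by blast
  define N where "N = sgn -` U \<inter> (- {0})"
  have "continuous_on (- {0::'a}) sgn"
    by (rule has_derivative_continuous_on, rule has_derivative_at_withinI, rule sgn_has_derivative) simp
  then have N: "open N"
    unfolding N_def using U(1) continuous_on_open_vimage[of "- {0::'a}" sgn] by auto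
  have yN: "y0 \<in> N" "0 \<notin> N" using U(2) y0 by (auto simp: N_def)
  define F where "F y = (\<alpha> * norm y powr (\<alpha> - 2) * w (sgn y)
      - norm y powr \<alpha> * (norm y powr (-3) * (g (sgn y) \<bullet> y))) *\<^sub>R y
      + (norm y powr \<alpha> * norm y powr (-1)) *\<^sub>R g (sgn y)" for y
  have "(V has_derivative (\<lambda>h. F y \<bullet> h)) (at y)" if y: "y \<in> N" for y
  proof -
    from y
    have y0: "y \<noteq> 0" and yU: "sgn y \<in> U" by (auto simp: N_def)
    have w: "((\<lambda>y. w (sgn y)) has_derivative (\<lambda>h. g (sgn y) \<bullet>
        (norm y powr (-1) *\<^sub>R h - (norm y powr (-3) * (y \<bullet> h)) *\<^sub>R y))) (at y)"
      by (rule has_derivative_compose[OF sgn_has_derivative[OF y0] g[OF yU]])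
    have "((\<lambda>y. norm y powr \<alpha> * w (sgn y)) has_derivative (\<lambda>h. F y \<bullet> h)) (at y)"
      unfolding F_def
      by (rule derivative_eq_intros has_derivative_norm_powr[OF y0] w refl)+
        (simp add: fun_eq_iff inner_add_left inner_diff_left inner_diff_right algebra_simps)
    then show ?thesis
      by (rule has_derivative_transform_within_open[OF _ N y])
        (use U(4) in \<open>auto simp: V_def N_def norm_sgn\<close>)
  qed
  moreover have "F differentiable (at y0)"
  proof -
    have dn: "(\<lambda>y. norm y powr \<beta>) differentiable (at y0)" for \<beta>
      unfolding differentiable_def using has_derivative_norm_powr[OF y0] by blast
    have ds: "sgn differentiable (at y0)"
      unfolding differentiable_def using sgn_has_derivative[OF y0] by blast
    have dw: "(\<lambda>y. w (sgn y)) differentiable (at y0)"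
      unfolding differentiable_def
      using has_derivative_compose[OF sgn_has_derivative[OF y0] g[OF U(2)]] by blast
    obtain g2 where g2: "(g has_derivative g2) (at (sgn y0))"
      using g'[OF U(2)] unfolding differentiable_def by blast
    have dg: "(\<lambda>y. g (sgn y)) differentiable (at y0)"
      unfolding differentiable_def
      using has_derivative_compose[OF sgn_has_derivative[OF y0] g2] by blast
    have dgi: "(\<lambda>y. g (sgn y) \<bullet> y) differentiable (at y0)"
      using dg unfolding differentiable_def
      using has_derivative_inner[OF _ has_derivative_ident] by blast
    show ?thesis
      unfolding F_def[abs_def]
      by (intro differentiable_add differentiable_diff differentiable_scaleR differentiable_mult
          differentiable_const differentiable_ident dn dw dg dgi)
  qed
  ultimately show ?thesis using N yN by blast
qed

text \<open>The local gradients depend on local extensions of \<open>v\<close>, but they agree wherever they are defined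
  since gradients are unique; hence they form one global field.\<close>

lemma C2_sphere_homogeneous_extension:
  fixes v :: "'a::euclidean_space \<Rightarrow> real" and \<alpha> :: real
  assumes v: "C2_sphere v"
  obtains G H where "homogeneous_hessian (\<lambda>y. norm y powr \<alpha> * v (sgn y)) \<alpha> G H"
proof -
  define V where "V = (\<lambda>y. norm y powr \<alpha> * v (sgn y))"
  define G where "G y = (SOME g. (V has_derivative (\<lambda>h. g \<bullet> h)) (at y))" for y
  have G: "(V has_derivative (\<lambda>h. G y \<bullet> h)) (at y)" if y: "y \<noteq> 0" for y
  proof -
    obtain N F where "y \<in> N" "\<forall>y\<in>N. (V has_derivative (\<lambda>h. F y \<bullet> h)) (at y)"
      using C2_sphere_local_gradient[OF v y, of \<alpha>, folded V_def] by blast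
    then have "\<exists>g. (V has_derivative (\<lambda>h. g \<bullet> h)) (at y)" by blast
    then show ?thesis unfolding G_def by (rule someI_ex)
  qed
  have "G differentiable (at y)" if y: "y \<noteq> 0" for y
  proof -
    obtain N F where N: "open N" "y \<in> N" "0 \<notin> N"
      and F: "\<forall>y\<in>N. (V has_derivative (\<lambda>h. F y \<bullet> h)) (at y)" "F differentiable (at y)"
      using C2_sphere_local_gradient[OF v y, of \<alpha>, folded V_def] by blast
    have "F z = G z" if "z \<in> N" for z
    proof -
      have "z \<noteq> 0" using that N by auto
      then have "(\<lambda>h. F z \<bullet> h) = (\<lambda>h. G z \<bullet> h)"
        using has_derivative_unique[OF bspec[OF F(1) that] G] by blast
      then have "\<forall>h. F z \<bullet> h = G z \<bullet> h" by (intro allI) (rule fun_cong)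
      then show ?thesis using vector_eq_rdot by blast
    qed
    moreover obtain D where "(F has_derivative D) (at y)"
      using F(2) unfolding differentiable_def by blast
    ultimately have "(G has_derivative D) (at y)"
      using has_derivative_transform_within_open[OF _ N(1,2)] by blast
    then show ?thesis unfolding differentiable_def by blast
  qed
  then have "(G has_derivative frechet_derivative G (at y)) (at y)" if "y \<noteq> 0" for y
    using that by (simp add: frechet_derivative_works)
  moreover have "V (s *\<^sub>R y) = s powr \<alpha> * V y" if "s > 0" "y \<noteq> 0" for s y
    using that by (simp add: V_def sgn_scaleR powr_mult)
  ultimately have "homogeneous_hessian V \<alpha> G (\<lambda>y. frechet_derivative G (at y))"
    using G by unfold_locales auto
  then show thesis unfolding V_def by (rule that)
qed

section \<open>Moving caps\<close>

lemma powr_diff_le: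
  fixes a b p :: real
  assumes "0 < b" "b \<le> a" "1 \<le> p"
  shows "a powr p - b powr p \<le> p * a powr (p - 1) * (a - b)"
proof (cases "b = a")
  case False
  then have "b < a" using assms by simp
  have "((\<lambda>s. s powr p) has_real_derivative p * x powr (p - 1)) (at x)" if "b \<le> x" for x
    using that assms(1) by (intro has_real_derivative_powr) auto
  then obtain z where z: "b < z" "z < a" "a powr p - b powr p = (a - b) * (p * z powr (p - 1))"
    using MVT2[OF \<open>b < a\<close>, of "\<lambda>s. s powr p" "\<lambda>s. p * s powr (p - 1)"] by blast
  have "p * z powr (p - 1) \<le> p * a powr (p - 1)"
    using z assms by (intro mult_left_mono powr_mono2) auto
  then show ?thesis using z(3) \<open>b < a\<close> by (simp add: mult.commute mult_left_mono)
qed simp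

text \<open>The extended equation in terms of \<open>g\<close>.  The value of \<open>\<alpha>\<close> is the one for which Lorentz reflections
  preserve Laplacians.\<close>

locale moving_caps = homogeneous_hessian V \<alpha> G H
  for V :: "'a::euclidean_space \<Rightarrow> real" and \<alpha> G H +
  fixes g :: "real \<Rightarrow> real" and p :: real
  assumes \<alpha>: "2 * \<alpha> = 3 - real DIM('a)"
    and dim: "4 \<le> DIM('a)"
    and pos: "y \<noteq> 0 \<Longrightarrow> 0 < V y"
    and p: "1 \<le> p"
    and g: "strict_antimono_on {0<..} g"
    and eq: "y \<noteq> 0 \<Longrightarrow> - op_trace (H y) = g (norm y powr (- \<alpha>) * V y) * V y powr p"
begin

lemma isCont_V: "y \<noteq> 0 \<Longrightarrow> isCont V y"
  using grad has_derivative_continuous by blast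

lemma tendsto_lorentz_reflection:
  assumes e: "norm e = 1" and t: "0 \<le> t" "t < 1" and x: "x \<noteq> 0"
    and T: "(T \<longlongrightarrow> t) F" and X: "(X \<longlongrightarrow> x) F"
  shows "((\<lambda>k. V (lorentz_reflection e (T k) (X k))) \<longlongrightarrow> V (lorentz_reflection e t x)) F"
proof (rule isCont_tendsto_compose[OF isCont_V])
  show "lorentz_reflection e t x \<noteq> 0" by (rule lorentz_reflection_nonzero[OF e t x])
  have "1 - t\<^sup>2 \<noteq> 0" using t by (auto simp: power2_eq_1_iff)
  then show "((\<lambda>k. lorentz_reflection e (T k) (X k)) \<longlongrightarrow> lorentz_reflection e t x) F"
    unfolding lorentz_reflection_def by (intro tendsto_intros T X)
qed

text \<open>On the sphere \<open>V\<close> lies between two positive constants, and \<open>g\<close> is bounded above by its value at the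
  lower one.\<close>

lemma linearization_bound:
  obtains C where "0 \<le> C" "\<And>x. norm x = 1 \<Longrightarrow> p * g (V x) * V x powr (p - 1) \<le> C"
proof -
  have ne: "sphere (0::'a) 1 \<noteq> {}" by simp
  have c: "continuous_on (sphere 0 1) V"
    by (intro continuous_at_imp_continuous_on ballI isCont_V) auto
  obtain x1 where x1: "norm x1 = 1" "\<And>x. norm x = 1 \<Longrightarrow> V x1 \<le> V x"
    using continuous_attains_inf[OF compact_sphere ne c] by auto
  obtain x2 where x2: "norm x2 = 1" "\<And>x. norm x = 1 \<Longrightarrow> V x \<le> V x2"
    using continuous_attains_sup[OF compact_sphere ne c] by auto
  show thesis
  proof (rule that[of "p * max 0 (g (V x1)) * V x2 powr (p - 1)"])
    show "0 \<le> p * max 0 (g (V x1)) * V x2 powr (p - 1)" using p by simp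
    fix x :: 'a assume x: "norm x = 1"
    have pos': "0 < V x1" "0 < V x" using x1(1) x pos by (auto intro: pos)
    have "g (V x) \<le> g (V x1)"
      using monotone_onD[OF g, of "V x1" "V x"] x1(2)[OF x] pos' by (cases "V x1 = V x") auto
    then have "g (V x) \<le> max 0 (g (V x1))" by simp
    moreover have "V x powr (p - 1) \<le> V x2 powr (p - 1)"
      using p x2(2)[OF x] pos' by (intro powr_mono2) auto
    ultimately have "g (V x) * V x powr (p - 1) \<le> max 0 (g (V x1)) * V x2 powr (p - 1)"
      by (intro mult_mono) auto
    then show "p * g (V x) * V x powr (p - 1) \<le> p * max 0 (g (V x1)) * V x2 powr (p - 1)"
      using p by (simp add: mult.assoc mult_left_mono)
  qed
qed

context
  fixes C :: real and e :: 'a and t :: real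
  assumes C: "0 \<le> C" "\<And>x. norm x = 1 \<Longrightarrow> p * g (V x) * V x powr (p - 1) \<le> C"
    and e: "norm e = 1" and t: "0 < t" "t < 1"
begin

text \<open>Let \<open>z = \<phi> x\<close>.  The argument of \<open>g\<close> in the equation at \<open>z\<close> is \<open>\<bar>z\<bar>\<^sup>-\<^sup>\<alpha> V z < V z \<le> V x\<close>, because
  \<open>\<bar>z\<bar> < 1\<close> and \<open>\<alpha> < 0\<close>.  So \<open>g\<close> is strictly larger there than at \<open>V x\<close>, and what remains is the
  difference \<open>g (V x) (V x\<^sup>p - V z\<^sup>p)\<close>, which is linearised by convexity if \<open>g (V x) > 0\<close> and is
  nonpositive otherwise.\<close>

lemma laplacian_difference_less:
  assumes x: "norm x = 1" "t < x \<bullet> e" and le: "V (lorentz_reflection e t x) \<le> V x"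
  obtains L where "has_laplacian (\<lambda>y. V (lorentz_reflection e t y) - V y) L x"
    and "L < C * (V x - V (lorentz_reflection e t x))"
proof -
  define z where "z = lorentz_reflection e t x"
  have x0: "x \<noteq> 0" using x by auto
  have z0: "z \<noteq> 0" unfolding z_def using lorentz_reflection_nonzero[OF e _ _ x0] t by simp
  have t2: "1 - t\<^sup>2 > 0" using t by (simp add: abs_square_less_1)
  have "norm z = 1 - 2 * t / (1 - t\<^sup>2) * (x \<bullet> e - t)"
    unfolding z_def using norm_lorentz_reflection[OF e, of t x] t x by simp
  moreover have "2 * t / (1 - t\<^sup>2) * (x \<bullet> e - t) > 0"
    using t t2 x by (intro mult_pos_pos divide_pos_pos) auto
  ultimately have nz: "norm z < 1" by simp
  have a: "\<alpha> < 0" using \<alpha> dim by simp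
  have "norm z powr (- \<alpha>) < 1 powr (- \<alpha>)"
    using nz z0 a by (intro powr_less_mono2) auto
  then have "norm z powr (- \<alpha>) * V z < V z" using pos[OF z0] by simp
  moreover have "0 < norm z powr (- \<alpha>) * V z" using pos[OF z0] z0 by simp
  ultimately have "g (V x) < g (norm z powr (- \<alpha>) * V z)"
    using monotone_onD[OF g, of "norm z powr (- \<alpha>) * V z" "V x"] le pos[OF x0]
    by (simp add: z_def)
  then have "g (V x) * V z powr p < - op_trace (H z)"
    unfolding eq[OF z0] using pos[OF z0] by simp
  moreover have "- op_trace (H x) = g (V x) * V x powr p"
    using eq[OF x0] x by simp
  ultimately have "op_trace (H z) - op_trace (H x) < g (V x) * (V x powr p - V z powr p)"
    by (simp add: algebra_simps)
  also have "\<dots> \<le> C * (V x - V z)"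
  proof (cases "g (V x) \<le> 0")
    case True
    have "V z powr p \<le> V x powr p"
      using le pos[OF z0] p by (intro powr_mono2) (auto simp: z_def)
    then have "g (V x) * (V x powr p - V z powr p) \<le> 0"
      using True by (intro mult_nonpos_nonneg) auto
    also have "0 \<le> C * (V x - V z)" using C(1) le by (simp add: z_def)
    finally show ?thesis .
  next
    case False
    have "g (V x) * (V x powr p - V z powr p) \<le> g (V x) * (p * V x powr (p - 1) * (V x - V z))"
      using False powr_diff_le[OF pos[OF z0] _ p] le by (intro mult_left_mono) (auto simp: z_def)
    also have "\<dots> = p * g (V x) * V x powr (p - 1) * (V x - V z)" by (simp add: algebra_simps)
    also have "\<dots> \<le> C * (V x - V z)"
      using C(2)[OF x(1)] le by (intro mult_right_mono) (auto simp: z_def)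
    finally show ?thesis .
  qed
  finally have "op_trace (H z) - op_trace (H x) < C * (V x - V z)" .
  moreover have "has_laplacian (\<lambda>y. V (lorentz_reflection e t y) - V y)
      (op_trace (H z) - op_trace (H x)) x"
    unfolding z_def using t x
    by (intro has_laplacian_diff has_laplacian_lorentz_reflection has_laplacian_V \<alpha> e x0) auto
  ultimately show thesis using that unfolding z_def by blast
qed

text \<open>Comparison with the barrier \<open>\<psi>\<close>, the homogeneous extension of degree \<open>\<alpha>\<close> of \<open>x \<bullet> e - t + \<eta>\<close>, which
  is positive on the cap and satisfies \<open>\<Delta>\<psi> \<le> - n x \<bullet> e\<close> on it.  If \<open>W + m \<psi> \<ge> 0\<close> on the cap with
  equality at \<open>x\<close>, then by homogeneity \<open>x\<close> is a local minimum in the ambient space, hence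
  \<open>0 \<le> \<Delta>W + m \<Delta>\<psi> < m C \<psi> - m n x \<bullet> e\<close>.  For \<open>m = 0\<close> this says that \<open>W \<ge> 0\<close> has no interior zero.\<close>

lemma touching_point:
  assumes \<eta>: "0 < \<eta>" and m: "0 \<le> m"
    and above: "\<And>y. norm y = 1 \<Longrightarrow> t < y \<bullet> e \<Longrightarrow>
       - m * (y \<bullet> e - t + \<eta>) \<le> V (lorentz_reflection e t y) - V y"
    and x: "norm x = 1" "t < x \<bullet> e"
    and touch: "V (lorentz_reflection e t x) - V x = - m * (x \<bullet> e - t + \<eta>)"
  shows "0 < m * (C * (x \<bullet> e - t + \<eta>) - (real DIM('a) - 1) * (x \<bullet> e))"
proof -
  define \<phi> where "\<phi> = lorentz_reflection e t"
  define a where "a = x \<bullet> e"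
  define n where "n = real DIM('a) - 1"
  have n: "\<alpha> = 1 - n / 2" "n \<ge> 3" using \<alpha> dim by (auto simp: n_def field_simps)
  have x0: "x \<noteq> 0" using x by auto
  have d: "0 < x \<bullet> e - t + \<eta>" using x \<eta> by simp
  have "V (\<phi> x) \<le> V x"
    using touch mult_nonneg_nonneg[OF m, of "x \<bullet> e - t + \<eta>"] d by (simp add: \<phi>_def)
  then obtain L where L: "has_laplacian (\<lambda>y. V (\<phi> y) - V y) L x" "L < C * (V x - V (\<phi> x))"
    using laplacian_difference_less[OF x] unfolding \<phi>_def by blast
  define \<psi> where "\<psi> y = norm y powr (\<alpha> - 1) * (y \<bullet> e) - (t - \<eta>) * norm y powr \<alpha>" for y
  define M where "M = (\<alpha> - 1) * (\<alpha> - 1 + DIM('a)) * (x \<bullet> e) - (t - \<eta>) * (\<alpha> * (\<alpha> + DIM('a) - 2))"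
  have M: "has_laplacian \<psi> M x"
    unfolding \<psi>_def[abs_def] M_def
    by (intro has_laplacian_diff has_laplacian_cmult has_laplacian_norm_powr
        has_laplacian_norm_powr_inner x(1))
  define u where "u y = (V (\<phi> y) - V y) + m * \<psi> y" for y
  have u: "has_laplacian u (L + m * M) x"
    unfolding u_def[abs_def] by (intro has_laplacian_add has_laplacian_cmult L M)
  have \<psi>1: "\<psi> y = y \<bullet> e - t + \<eta>" if "norm y = 1" for y
    using that by (simp add: \<psi>_def)
  have u0: "u x = 0" using touch \<psi>1[OF x(1)] by (simp add: u_def \<phi>_def)
  have "0 \<le> u y" if y: "y \<noteq> 0" "t * norm y < y \<bullet> e" for y
  proof -
    define w where "w = sgn y"
    have w: "norm w = 1" "y = norm y *\<^sub>R w" "w \<noteq> 0"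
      using y(1) by (auto simp: w_def norm_sgn sgn_div_norm)
    have "norm y * t < norm y * (w \<bullet> e)"
      using y(2) arg_cong[OF w(2), of "\<lambda>z. z \<bullet> e"] by (simp add: mult.commute)
    then have "t < w \<bullet> e" using y(1) by simp
    then have "0 \<le> u w" using above[OF w(1)] \<psi>1[OF w(1)] by (simp add: u_def \<phi>_def)
    moreover have "u (s *\<^sub>R w) = s powr \<alpha> * u w" if s: "s > 0" for s
    proof -
      have "V (\<phi> (s *\<^sub>R w)) = s powr \<alpha> * V (\<phi> w)"
        unfolding \<phi>_def lorentz_reflection_scaleR[OF s]
        using lorentz_reflection_nonzero[OF e _ _ w(3)] t by (intro hom s) auto
      moreover have "s powr \<alpha> = s powr (\<alpha> - 1) * s" using s by (simp add: powr_diff)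
      then have "\<psi> (s *\<^sub>R w) = s powr \<alpha> * \<psi> w"
        using s w(1) by (simp add: \<psi>_def algebra_simps)
      ultimately show ?thesis
        unfolding u_def hom[OF s w(3)] by (simp add: algebra_simps)
    qed
    from this[of "norm y"] have "u y = norm y powr \<alpha> * u w" using y(1) w(2) by simp
    ultimately show ?thesis by simp
  qed
  moreover have "\<forall>\<^sub>F y in nhds x. y \<noteq> 0 \<and> t * norm y < y \<bullet> e"
  proof -
    have "open {y. t * norm y < y \<bullet> e}"
      by (intro open_Collect_less continuous_intros)
    then have "open ({y. t * norm y < y \<bullet> e} - {0})" by (rule open_delete)
    then show ?thesis
      using eventually_nhds_in_open[of "{y. t * norm y < y \<bullet> e} - {0}" x] x x0
      by (auto elim: eventually_mono)
  qed
  ultimately have "\<forall>\<^sub>F y in nhds x. u x \<le> u y"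
    using u0 by (auto elim: eventually_mono)
  then have "0 \<le> L + m * M" by (rule local_min_laplacian_nonneg[OF u])
  moreover have "M = - (n / 2 * (n / 2 - 1) * (a - t + \<eta>)) - n * a"
  proof -
    have "M = (\<alpha> - 1) * (\<alpha> + n) * a - (t - \<eta>) * (\<alpha> * (\<alpha> + n - 1))"
      unfolding M_def a_def n_def by (simp add: algebra_simps)
    then show ?thesis unfolding n(1) by (simp add: field_simps)
  qed
  moreover have "0 \<le> n / 2 * (n / 2 - 1) * (a - t + \<eta>)"
    using n(2) d unfolding a_def by (intro mult_nonneg_nonneg) auto
  ultimately have "0 \<le> L - m * (n * a)"
    using mult_left_mono[OF _ m, of M "- n * a"] by simp
  moreover have "V x - V (\<phi> x) = m * (x \<bullet> e - t + \<eta>)"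
    using touch by (simp add: \<phi>_def)
  then have "C * (V x - V (\<phi> x)) = m * (C * (x \<bullet> e - t + \<eta>))" by simp
  ultimately have "0 < m * (C * (x \<bullet> e - t + \<eta>)) - m * (n * a)"
    using L(2) by linarith
  then show ?thesis by (simp add: n_def a_def right_diff_distrib)
qed

text \<open>Consider a minimum point \<open>x\<close> of \<open>W / (x \<bullet> e - t + \<eta>)\<close> on the closed cap, where the minimum is
  negative.  It is not on the boundary, where \<open>W = 0\<close>.  If it were at height less than \<open>\<eta>\<close> over the
  boundary, the barrier would be below \<open>2 \<eta>\<close> there, and \<open>touching_point\<close> would give
  \<open>n x \<bullet> e < 2 \<eta> C \<le> t\<close>, contradicting \<open>x \<bullet> e > t\<close>.\<close>

lemma negative_point_deep_in_cap:
  assumes \<eta>: "0 < \<eta>" "2 * \<eta> * C \<le> t"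
    and neg: "\<exists>x. norm x = 1 \<and> t < x \<bullet> e \<and> V (lorentz_reflection e t x) < V x"
  shows "\<exists>x. norm x = 1 \<and> t + \<eta> \<le> x \<bullet> e \<and> V (lorentz_reflection e t x) < V x"
proof -
  define W where "W y = V (lorentz_reflection e t y) - V y" for y
  define r where "r y = W y / (y \<bullet> e - t + \<eta>)" for y
  define K where "K = sphere 0 1 \<inter> {y. t \<le> y \<bullet> e}"
  have Kc: "compact K" unfolding K_def
    by (intro compact_Int_closed compact_sphere closed_Collect_le continuous_intros)
  have den: "0 < y \<bullet> e - t + \<eta>" if "y \<in> K" for y using that \<eta> by (auto simp: K_def)
  have "continuous_on K r"
    unfolding continuous_on_def
  proof
    fix y assume y: "y \<in> K"
    then have y0: "y \<noteq> 0" by (auto simp: K_def)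
    have "(V \<longlongrightarrow> V y) (at y within K)"
      using isCont_V[OF y0] continuous_at_imp_continuous_at_within continuous_within by blast
    moreover have "((\<lambda>y. V (lorentz_reflection e t y)) \<longlongrightarrow> V (lorentz_reflection e t y)) (at y within K)"
      using t by (intro tendsto_lorentz_reflection e y0 tendsto_const tendsto_ident_at) auto
    ultimately show "(r \<longlongrightarrow> r y) (at y within K)"
      unfolding r_def W_def using den[OF y] by (intro tendsto_intros) auto
  qed
  moreover obtain x1 where x1: "norm x1 = 1" "t < x1 \<bullet> e" "W x1 < 0"
    using neg by (auto simp: W_def)
  then have x1K: "x1 \<in> K" by (simp add: K_def)
  ultimately obtain x where xK: "x \<in> K" and xmin: "\<And>y. y \<in> K \<Longrightarrow> r x \<le> r y"
    using continuous_attains_inf[OF Kc] by blast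
  have x: "norm x = 1" "t \<le> x \<bullet> e" using xK by (auto simp: K_def)
  have "r x1 < 0" using x1(3) den[OF x1K] by (simp add: r_def divide_neg_pos)
  then have r0: "r x < 0" using xmin[OF x1K] by simp
  have "x \<bullet> e \<noteq> t"
    using r0 x by (auto simp: r_def W_def lorentz_reflection_def)
  then have xt: "t < x \<bullet> e" using x by simp
  have Wx: "W x = r x * (x \<bullet> e - t + \<eta>)" using den[OF xK] by (simp add: r_def)
  show ?thesis
  proof (cases "t + \<eta> \<le> x \<bullet> e")
    case True
    have "W x < 0" unfolding Wx using r0 den[OF xK] by (simp add: mult_neg_pos)
    then show ?thesis using True x(1) by (auto simp: W_def)
  next
    case False
    have "0 < (- r x) * (C * (x \<bullet> e - t + \<eta>) - (real DIM('a) - 1) * (x \<bullet> e))"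
    proof (rule touching_point[OF \<eta>(1) _ _ x(1) xt])
      show "0 \<le> - r x" using r0 by simp
      show "V (lorentz_reflection e t x) - V x = - (- r x) * (x \<bullet> e - t + \<eta>)"
        using Wx by (simp add: W_def)
      fix y :: 'a assume y: "norm y = 1" "t < y \<bullet> e"
      then have yK: "y \<in> K" by (simp add: K_def)
      have "r x * (y \<bullet> e - t + \<eta>) \<le> r y * (y \<bullet> e - t + \<eta>)"
        using xmin[OF yK] den[OF yK] by (intro mult_right_mono) auto
      then show "- (- r x) * (y \<bullet> e - t + \<eta>) \<le> V (lorentz_reflection e t y) - V y"
        using den[OF yK] by (simp add: r_def W_def)
    qed
    then have "0 < C * (x \<bullet> e - t + \<eta>) - (real DIM('a) - 1) * (x \<bullet> e)"
      by (rule zero_less_mult_pos) (use r0 in simp)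
    then have "(real DIM('a) - 1) * (x \<bullet> e) < C * (x \<bullet> e - t + \<eta>)" by simp
    also have "\<dots> \<le> C * (2 * \<eta>)"
      using False C(1) by (intro mult_left_mono) auto
    also have "\<dots> \<le> t" using \<eta>(2) by (simp add: mult.commute mult.assoc)
    finally have "(real DIM('a) - 1) * (x \<bullet> e) < x \<bullet> e" using xt by simp
    moreover have "1 * (x \<bullet> e) \<le> (real DIM('a) - 1) * (x \<bullet> e)"
      using dim xt t by (intro mult_right_mono) auto
    ultimately show ?thesis by simp
  qed
qed

end

text \<open>If the claim fails at \<open>t\<close>, let \<open>\<sigma>\<close> be the supremum of the parameters in \<open>[t, 1)\<close> at which it fails.
  At each of these there is a negative point at height at least \<open>\<eta>\<close> over the boundary, with one
  \<open>\<eta>\<close> for all of them; this bounds \<open>\<sigma>\<close> away from 1 and yields in the limit a point inside the cap of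
  parameter \<open>\<sigma>\<close> where \<open>W \<le> 0\<close>.  But \<open>W \<ge> 0\<close> on that cap, as a limit from larger parameters, so
  this is an interior zero.\<close>

lemma reflected_ge_on_cap:
  assumes e: "norm e = 1" and t: "0 < t" "t < 1" and x: "norm x = 1" "t < x \<bullet> e"
  shows "V x \<le> V (lorentz_reflection e t x)"
proof (rule ccontr)
  assume neg: "\<not> V x \<le> V (lorentz_reflection e t x)"
  obtain C where C: "0 \<le> C" "\<And>x. norm x = 1 \<Longrightarrow> p * g (V x) * V x powr (p - 1) \<le> C"
    using linearization_bound by blast
  define B where "B = {s. t \<le> s \<and> s < 1 \<and>
    (\<exists>x. norm x = 1 \<and> s < x \<bullet> e \<and> V (lorentz_reflection e s x) < V x)}"
  have tB: "t \<in> B" using neg x t by (auto simp: B_def)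
  define \<eta> where "\<eta> = t / (2 * (C + 1))"
  have \<eta>: "0 < \<eta>" using t C(1) by (simp add: \<eta>_def)
  have "2 * \<eta> * C = t * (C / (C + 1))" using C(1) by (simp add: \<eta>_def field_simps)
  also have "\<dots> \<le> t * 1" using t C(1) by (intro mult_left_mono) auto
  finally have \<eta>C: "2 * \<eta> * C \<le> t" by simp
  have deep: "\<exists>x. norm x = 1 \<and> s + \<eta> \<le> x \<bullet> e \<and> V (lorentz_reflection e s x) < V x" if "s \<in> B" for s
    using that t \<eta>C unfolding B_def
    by (intro negative_point_deep_in_cap[OF C e _ _ \<eta>]) auto
  have le1: "x \<bullet> e \<le> 1" if "norm x = 1" for x
    using norm_cauchy_schwarz[of x e] e that by simp
  have Bup: "s \<le> 1 - \<eta>" if "s \<in> B" for s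
    using deep[OF that] le1 by force
  define \<sigma> where "\<sigma> = Sup B"
  have bdd: "bdd_above B" by (rule bdd_aboveI) (rule Bup)
  have \<sigma>: "t \<le> \<sigma>" "\<sigma> \<le> 1 - \<eta>"
    unfolding \<sigma>_def using tB bdd Bup by (auto intro: cSup_upper cSup_least)
  have \<sigma>01: "0 < \<sigma>" "\<sigma> < 1" using \<sigma> t \<eta> by auto
  have "\<sigma> \<in> closure B" unfolding \<sigma>_def by (rule closure_contains_Sup) (use tB bdd in auto)
  then obtain S where S: "\<And>k. S k \<in> B" "S \<longlonglongrightarrow> \<sigma>"
    unfolding closure_sequential by blast
  obtain X where X: "\<And>k. norm (X k) = 1" "\<And>k. S k + \<eta> \<le> X k \<bullet> e"
    "\<And>k. V (lorentz_reflection e (S k) (X k)) < V (X k)"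
    using deep[OF S(1)] by metis
  obtain x' r where x': "x' \<in> sphere 0 1" and r: "strict_mono r" and Xr: "(X \<circ> r) \<longlonglongrightarrow> x'"
    using compact_sphere[of "0::'a" 1] X(1) unfolding compact_def
    by (metis dist_0_norm mem_sphere)
  have n1: "norm x' = 1" and x0: "x' \<noteq> 0" using x' by auto
  have Sr: "(S \<circ> r) \<longlonglongrightarrow> \<sigma>" using S(2) r by (rule LIMSEQ_subseq_LIMSEQ)
  have "(\<lambda>k. V (lorentz_reflection e ((S \<circ> r) k) ((X \<circ> r) k))) \<longlonglongrightarrow> V (lorentz_reflection e \<sigma> x')"
    using \<sigma>01 by (intro tendsto_lorentz_reflection e x0 Sr Xr) auto
  moreover have "(\<lambda>k. V ((X \<circ> r) k)) \<longlonglongrightarrow> V x'"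
    by (rule isCont_tendsto_compose[OF isCont_V[OF x0] Xr])
  ultimately have Wle: "V (lorentz_reflection e \<sigma> x') \<le> V x'"
    by (rule LIMSEQ_le) (use X(3) in \<open>auto intro: less_imp_le\<close>)
  have "\<sigma> + \<eta> \<le> x' \<bullet> e"
    by (rule LIMSEQ_le[of "\<lambda>k. (S \<circ> r) k + \<eta>" _ "\<lambda>k. (X \<circ> r) k \<bullet> e"])
      (use X(2) in \<open>auto intro!: tendsto_intros Sr[unfolded o_def] Xr[unfolded o_def]\<close>)
  then have xe: "\<sigma> < x' \<bullet> e" using \<eta> by simp
  have ge: "V y \<le> V (lorentz_reflection e \<sigma> y)" if y: "norm y = 1" "\<sigma> < y \<bullet> e" for y
  proof (rule tendsto_lowerbound)
    show "((\<lambda>s. V (lorentz_reflection e s y)) \<longlongrightarrow> V (lorentz_reflection e \<sigma> y)) (at_right \<sigma>)"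
      using \<sigma>01 y by (intro tendsto_lorentz_reflection e tendsto_const tendsto_ident_at) auto
    show "\<forall>\<^sub>F s in at_right \<sigma>. V y \<le> V (lorentz_reflection e s y)"
    proof (rule eventually_at_rightI[OF _ y(2)])
      fix s assume s: "s \<in> {\<sigma><..<y \<bullet> e}"
      then have "s \<notin> B" using cSup_upper[OF _ bdd, of s] by (auto simp: \<sigma>_def)
      then show "V y \<le> V (lorentz_reflection e s y)"
        using s y \<sigma>(1) le1[OF y(1)] by (force simp: B_def)
    qed
  qed simp
  \<comment> \<open>At an interior zero the barrier enters with the factor \<open>m = 0\<close>; any positive \<open>\<eta>\<close> serves, here 1.\<close>
  have "0 < 0 * (C * (x' \<bullet> e - \<sigma> + 1) - (real DIM('a) - 1) * (x' \<bullet> e))"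
    by (rule touching_point[OF C e \<sigma>01]) (use ge n1 xe Wle ge[OF n1 xe] in auto)
  then show False by simp
qed

text \<open>For \<open>t = 0\<close> the Lorentz reflection is the mirror reflection along \<open>e\<close>, and the mirror
  along \<open>x - y\<close> exchanges \<open>x\<close> and \<open>y\<close>.  The inequality for \<open>t > 0\<close> passes to the limit and can be used
  in both directions.\<close>

lemma constant_on_sphere:
  assumes x: "norm x = 1" and y: "norm y = 1"
  shows "V x = V y"
proof -
  have le: "V x \<le> V y" if x: "norm x = 1" and y: "norm y = 1" for x y
  proof (cases "x = y")
    case False
    define d where "d = norm (x - y)"
    define e where "e = (x - y) /\<^sub>R d"
    have d: "d > 0" using False by (simp add: d_def)
    have e: "norm e = 1" using d by (simp add: e_def d_def)
    have xx: "x \<bullet> x = 1" "y \<bullet> y = 1" using x y by (simp_all add: dot_square_norm)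
    have "2 * (1 - x \<bullet> y) = d\<^sup>2"
      unfolding d_def power2_norm_eq_inner
      using xx by (simp add: inner_diff_left inner_diff_right inner_commute)
    then have xy: "1 - x \<bullet> y = d\<^sup>2 / 2" by simp
    have "x \<bullet> e = (1 - x \<bullet> y) / d"
      unfolding e_def using xx by (simp add: inner_diff_right divide_inverse mult.commute)
    then have xe: "x \<bullet> e = d / 2" unfolding xy by (simp add: power2_eq_square)
    have "V x \<le> V (lorentz_reflection e 0 x)"
    proof (rule tendsto_lowerbound)
      show "((\<lambda>s. V (lorentz_reflection e s x)) \<longlongrightarrow> V (lorentz_reflection e 0 x)) (at_right 0)"
        using x by (intro tendsto_lorentz_reflection e tendsto_const tendsto_ident_at) auto
      show "\<forall>\<^sub>F s in at_right 0. V x \<le> V (lorentz_reflection e s x)"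
      proof (rule eventually_at_rightI)
        show "0 < min 1 (x \<bullet> e)" using xe d by simp
        fix s assume "s \<in> {0<..<min 1 (x \<bullet> e)}"
        then show "V x \<le> V (lorentz_reflection e s x)"
          by (intro reflected_ge_on_cap e x) auto
      qed
    qed simp
    moreover have "lorentz_reflection e 0 x = y"
    proof -
      have "lorentz_reflection e 0 x = x - d *\<^sub>R e" by (simp add: lorentz_reflection_def xe)
      then show ?thesis using d by (simp add: e_def)
    qed
    ultimately show ?thesis by simp
  qed simp
  show ?thesis using le[OF x y] le[OF y x] by simp
qed

end

section \<open>Constancy of solutions\<close>

theorem corollary1p3:
  fixes n :: nat and f :: "real \<Rightarrow> real" and v :: "'a::euclidean_space \<Rightarrow> real"
  assumes "DIM('a) = n + 1" and "n \<ge> 3"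
    and "continuous_on {0..} f"
    and "strict_antimono_on {0<..} (\<lambda>s. s powr (- ((real n + 2) / (real n - 2))) * f s)"
    and "C2_sphere v"
    and "\<forall>x\<in>sphere 0 1. - conformal_laplacian n v x = f (v x)"
    and "\<forall>x\<in>sphere 0 1. v x > 0"
  shows "\<exists>c. (\<forall>x\<in>sphere 0 1. v x = c) \<and> f c = real n * (real n - 2) / 4 * c"
proof -
  define \<alpha> where "\<alpha> = 1 - real n / 2"
  define p where "p = (real n + 2) / (real n - 2)"
  define g where "g s = s powr (- p) * f s" for s
  define V where "V y = norm y powr \<alpha> * v (sgn y)" for y
  have n: "real n \<ge> 3" using assms(2) by simp
  obtain G H where "homogeneous_hessian V \<alpha> G H"
    using C2_sphere_homogeneous_extension[OF assms(5), of \<alpha>] unfolding V_def[abs_def] by blast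
  then interpret homogeneous_hessian V \<alpha> G H .
  have Vv: "V x = v x" if "norm x = 1" for x
    using that by (simp add: V_def sgn_div_norm)
  have eq1: "op_trace (H x) = - f (v x)" if x: "norm x = 1" for x
  proof -
    have "sphere_laplacian v x = op_trace (H x) - \<alpha> * (\<alpha> + DIM('a) - 2) * V x"
      by (rule sphere_laplacian_eq[OF x]) (use Vv in auto)
    moreover have "\<alpha> * (\<alpha> + DIM('a) - 2) = - (real n * (real n - 2) / 4)"
      unfolding assms(1) \<alpha>_def by (simp add: field_simps)
    ultimately have "conformal_laplacian n v x = op_trace (H x)"
      unfolding conformal_laplacian_def using Vv[OF x] by simp
    moreover have "- conformal_laplacian n v x = f (v x)" using assms(6) x by simp
    ultimately show ?thesis by simp
  qed
  \<comment> \<open>This relation between the exponents makes the powers of \<open>\<bar>y\<bar>\<close> in the extended equation cancel.\<close>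
  have \<alpha>p: "\<alpha> * p = \<alpha> - 2"
    unfolding \<alpha>_def p_def using n by (simp add: field_simps)
  interpret moving_caps V \<alpha> G H g p
  proof
    show "2 * \<alpha> = 3 - real DIM('a)" unfolding assms(1) \<alpha>_def by simp
    show "4 \<le> DIM('a)" using assms(1,2) by simp
    show "1 \<le> p" unfolding p_def using n by simp
    show "strict_antimono_on {0<..} g" using assms(4) unfolding g_def[abs_def] p_def .
    fix y :: 'a assume y: "y \<noteq> 0"
    define z where "z = sgn y"
    have z: "norm z = 1" "y = norm y *\<^sub>R z" "z \<noteq> 0"
      using y by (auto simp: z_def norm_sgn sgn_div_norm)
    have vz: "0 < v z" using assms(7) z(1) by simp
    have Vy: "V y = norm y powr \<alpha> * v z" by (simp add: V_def z_def)
    show "0 < V y" unfolding Vy using vz y by simp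
    have "H y = (\<lambda>h. norm y powr (\<alpha> - 2) *\<^sub>R H z h)"
      using H_homogeneous[of "norm y" z] y z(2,3) by auto
    then have "op_trace (H y) = norm y powr (\<alpha> - 2) * op_trace (H z)"
      by (simp only: op_trace_scaleR)
    then have 1: "- op_trace (H y) = norm y powr (\<alpha> - 2) * f (v z)" using eq1[OF z(1)] by simp
    have 2: "norm y powr (- \<alpha>) * V y = v z" unfolding Vy using y by (simp add: powr_minus)
    have 3: "V y powr p = norm y powr (\<alpha> - 2) * v z powr p"
      unfolding Vy using vz by (simp add: powr_mult powr_powr \<alpha>p)
    show "- op_trace (H y) = g (norm y powr (- \<alpha>) * V y) * V y powr p"
      unfolding 1 2 3 g_def using vz by (simp add: powr_minus)
  qed
  obtain x0 :: 'a where x0: "norm x0 = 1" using vector_choose_size[of 1] by auto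
  define c where "c = v x0"
  have vc: "v x = c" if "norm x = 1" for x
    using constant_on_sphere[OF that x0] Vv that x0 by (simp add: c_def)
  have "x0 \<noteq> 0" using x0 by auto
  \<comment> \<open>The extension of the constant \<open>c\<close> is \<open>c \<bar>y\<bar>\<^sup>\<alpha>\<close>, whose Laplacian is explicit.\<close>
  have "op_trace (H x0) = c * (\<alpha> * (\<alpha> + DIM('a) - 2))"
  proof (rule has_laplacian_unique)
    show "has_laplacian V (op_trace (H x0)) x0" using \<open>x0 \<noteq> 0\<close> by (rule has_laplacian_V)
    show "has_laplacian (\<lambda>y. c * norm y powr \<alpha>) (c * (\<alpha> * (\<alpha> + DIM('a) - 2))) x0"
      by (intro has_laplacian_cmult has_laplacian_norm_powr x0)
    show "\<forall>\<^sub>F y in nhds x0. V y = c * norm y powr \<alpha>"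
      by (rule eventually_mono[OF t1_space_nhds[OF \<open>x0 \<noteq> 0\<close>]])
        (simp add: V_def vc norm_sgn)
  qed
  then have "f c = real n * (real n - 2) / 4 * c"
    unfolding eq1[OF x0] c_def[symmetric] assms(1) \<alpha>_def by (simp add: field_simps)
  then show ?thesis using vc by auto
qed

end
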